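(* Let \[ N_1=4,\; N_2=8,\; N_3=10,\; N_4=14,\; N_5=18,\; N_6=22,\; N_7=26,\; N_8=30. \] Let $s$ and $d$ be integers such that $1\le s\le 8$ and $d\ge N_s$. Then at least the last $s$ integers in the saturation sequence $(\alpha_1,\dots,\alpha_{e_d-1})$ of $d$ are all equal to $3$; that is, $\alpha_{e_d-j}=3$ for all $1\le j\le s$.
   Context: The base field is $\mathbf Q$. For binary forms $A,B$ in $x_1,x_2$ of orders $p,q$ (with coefficients in any commutative $\mathbf Q$-algebra), the $r$-th transvectant is \[ (A,B)_r = \frac{(p-r)!\,(q-r)!}{p!\,q!}\sum_{i=0}^r (-1)^i\binom{r}{i}\frac{\partial^r A}{\partial x_1^{r-i}\partial x_2^i}\,\frac{\partial^r B}{\partial x_1^i\partial x_2^{r-i}} \] for $0\le r\le \min(p,q)$; it has order $p+q-2r$ in $x_1,x_2$. For an integer $d\ge 4$, let $R=\mathbf Q[a_0,\dots,a_d]$ with its standard grading, and let $\mathbb F=\sum_{i=0}^d\binom{d}{i}a_i x_1^{d-i}x_2^i$ be the generic binary form of order $d$. Let $e_d=\lfloor d/2\rfloor$ and, for $1\le q\le e_d$, let $\mathbb H_{2q}=(\mathbb F,\mathbb F)_{2q}$, a form of order $2d-4q$ in $x_1,x_2$ whose coefficients lie in $R_2$. Let $J_{2q}\subseteq R$ be the ideal generated by all the coefficients (with respect to $x_1,x_2$) of $\mathbb H_2,\mathbb H_4,\dots,\mathbb H_{2q}$. Then $J_2\subseteq J_4\subseteq\dots\subseteq J_{2e_d}=I_C$,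 where $I_C$ is the homogeneous ideal of the rational normal curve of degree $d$ in $\mathbf P^d$. It is known that the saturation of $J_2$ is $I_C$, so all the $J_{2q}$ agree in sufficiently high degrees. For $1\le q\le e_d-1$ define \[ \alpha_q=\min\{m : (J_{2q})_t=(J_{2q+2})_t \text{ for all } t\ge m\}, \] where the subscript $t$ denotes the degree-$t$ graded piece. The sequence $(\alpha_1,\dots,\alpha_{e_d-1})$ is called the saturation sequence of $d$. *)

theory Defs
  imports
    "HOL-Library.Poly_Mapping"
    "HOL-Computational_Algebra.Polynomial"
    "HOL-Algebra.Ideal"
begin

(* Polynomials over Q in the variables a_0, a_1, a_2, ...; a monomial is its exponent vector. *)
type_synonym qmpoly = "(nat \<Rightarrow>\<^sub>0 nat) \<Rightarrow>\<^sub>0 rat"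

definition const_q :: "rat \<Rightarrow> qmpoly" where
  "const_q c = Poly_Mapping.single 0 c"

definition var_a :: "nat \<Rightarrow> qmpoly" where
  "var_a i = Poly_Mapping.single (Poly_Mapping.single i 1) 1"

definition mon_degree :: "(nat \<Rightarrow>\<^sub>0 nat) \<Rightarrow> nat" where
  "mon_degree m = (\<Sum>i\<in>Poly_Mapping.keys m. Poly_Mapping.lookup m i)"

definition poly_ring :: "nat \<Rightarrow> qmpoly ring" where
  "poly_ring d =
    \<lparr>carrier = {f. \<forall>m\<in>Poly_Mapping.keys f. Poly_Mapping.keys m \<subseteq> {0..d}},
     monoid.mult = (*), one = 1, zero = 0, add = (+)\<rparr>"

lemma cring_poly_ring: "cring (poly_ring d)"
proof -
  let ?S = "{f :: qmpoly. \<forall>m\<in>Poly_Mapping.keys f. Poly_Mapping.keys m \<subseteq> {0..d}}"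
  have add: "f + g \<in> ?S" if "f \<in> ?S" "g \<in> ?S" for f g
    using that Poly_Mapping.keys_add[of f g] by blast
  have mult: "f * g \<in> ?S" if "f \<in> ?S" "g \<in> ?S" for f g
  proof -
    have "Poly_Mapping.keys m \<subseteq> {0..d}" if m: "m \<in> Poly_Mapping.keys (f * g)" for m
    proof -
      obtain u v where "m = u + v" "u \<in> Poly_Mapping.keys f" "v \<in> Poly_Mapping.keys g"
        using m keys_mult[of f g] by blast
      then show ?thesis
        using \<open>f \<in> ?S\<close> \<open>g \<in> ?S\<close> Poly_Mapping.keys_add[of u v] by blast
    qed
    then show ?thesis by blast
  qed
  have uminus: "- f \<in> ?S" if "f \<in> ?S" for f
    using that by simp
  have inv: "\<exists>g\<in>?S. g + f = 0" if "f \<in> ?S" for f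
    using uminus[OF that] by (intro bexI[of _ "- f"]) auto
  have one: "1 \<in> ?S" by simp
  have "abelian_group (poly_ring d)"
  proof (rule abelian_groupI)
    fix f assume "f \<in> carrier (poly_ring d)"
    then show "\<exists>g\<in>carrier (poly_ring d). g \<oplus>\<^bsub>poly_ring d\<^esub> f = \<zero>\<^bsub>poly_ring d\<^esub>"
      using inv[of f] by (simp only: poly_ring_def partial_object.simps monoid.simps ring.simps)
  next
    fix f g assume "f \<in> carrier (poly_ring d)" "g \<in> carrier (poly_ring d)"
    then show "f \<oplus>\<^bsub>poly_ring d\<^esub> g \<in> carrier (poly_ring d)"
      using add[of f g] by (simp only: poly_ring_def partial_object.simps monoid.simps ring.simps)
  qed (simp_all add: poly_ring_def add.assoc add.commute)
  moreover have "comm_monoid (poly_ring d)"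
  proof (rule comm_monoidI)
    fix f g assume "f \<in> carrier (poly_ring d)" "g \<in> carrier (poly_ring d)"
    then show "f \<otimes>\<^bsub>poly_ring d\<^esub> g \<in> carrier (poly_ring d)"
      using mult[of f g] by (simp only: poly_ring_def partial_object.simps monoid.simps ring.simps)
  qed (simp_all add: poly_ring_def mult.assoc mult.commute)
  ultimately show ?thesis
    by (rule cringI) (simp add: poly_ring_def distrib_right)
qed

definition graded_part :: "qmpoly set \<Rightarrow> nat \<Rightarrow> qmpoly set" where
  "graded_part I t = {f \<in> I. \<forall>m\<in>Poly_Mapping.keys f. mon_degree m = t}"

(* Polynomials in x1, x2: the outer variable is x1, the inner one is x2. *)
type_synonym biv = "qmpoly poly poly"

definition dx1 :: "biv \<Rightarrow> biv" where
  "dx1 A = pderiv A"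

definition dx2 :: "biv \<Rightarrow> biv" where
  "dx2 A = map_poly pderiv A"

(* The orders p, q are explicit arguments, because the zero form has every order. *)
definition transvectant :: "nat \<Rightarrow> nat \<Rightarrow> nat \<Rightarrow> biv \<Rightarrow> biv \<Rightarrow> biv" where
  "transvectant p q r A B =
    smult [:const_q (fact (p - r) * fact (q - r) / (fact p * fact q)):]
      (\<Sum>i=0..r. (-1) ^ i * of_nat (r choose i) *
         (dx1 ^^ (r - i)) ((dx2 ^^ i) A) * (dx1 ^^ i) ((dx2 ^^ (r - i)) B))"

definition generic_form :: "nat \<Rightarrow> biv" where
  "generic_form d = (\<Sum>i=0..d. monom (monom (of_nat (d choose i) * var_a i) i) (d - i))"

definition covariant_H :: "nat \<Rightarrow> nat \<Rightarrow> biv" where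
  "covariant_H d k = transvectant d d k (generic_form d) (generic_form d)"

definition form_coeffs :: "biv \<Rightarrow> qmpoly set" where
  "form_coeffs A = {coeff (coeff A i) j | i j. True}"

(* The argument q gives J_{2q}. *)
definition ideal_J :: "nat \<Rightarrow> nat \<Rightarrow> qmpoly set" where
  "ideal_J d q = Idl\<^bsub>poly_ring d\<^esub> (\<Union>k\<in>{1..q}. form_coeffs (covariant_H d (2 * k)))"

definition sat_alpha :: "nat \<Rightarrow> nat \<Rightarrow> nat" where
  "sat_alpha d q =
    (LEAST m. \<forall>t\<ge>m. graded_part (ideal_J d q) t = graded_part (ideal_J d (q + 1)) t)"

definition bound_N :: "nat \<Rightarrow> nat" where
  "bound_N s = [4, 8, 10, 14, 18, 22, 26, 30] ! (s - 1)"

end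

(*
Dually, a linear functional on cubic polynomials is a symmetric array u i j k = phi (a_i a_j a_k) with indices in
0..d, and phi kills the ideal generated by H_2, ..., H_(n-2) iff the transvectants of u of even orders 0 < r < n in
one pair of indices vanish.  Let n be even with d/2 < n <= d.  Then such a u depends only on i + j + k, so that all
its transvectants of positive order vanish and H_n contributes nothing new in degree three (hence in any higher
degree).  By induction on the weight w = i + j + k it is enough to show that an array killed by the raising operator
a_i -> (d - i) a_(i+1) is zero in every weight w > 0.  Apolarity forces u i j k to depend only on i + j as long as
i + j < n.  If the resulting constants vanish, the binary form P i j 0 has its exponents in the window n..d of length
at most n and n vanishing binomial moments, so it is zero.  The constants do vanish: they alternate in sign
with strictly decreasing absolute values, which is incompatible with symmetry if w <= 2n - 3, and for w = 2n - 2
and w = 2n - 1 an alternating sum of hypergeometric terms comes out too large as soon as n >= 6.  In degree two,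
the array of the form (x - y)^n separates H_n from the lower transvectants.
*)
theory Submission imports Defs begin

subsection \<open>Binomial sums\<close>

text \<open>The engine is sl_2-equivariance: a transvectant of a raised array is a combination of
  transvectants of the array itself, so raising preserves the apolarity conditions. An array killed
  by raising, once weighted by binomials, is a translation invariant polynomial in x, y, z, hence
  determined by its part at z = 0. The obstacle is the corner value \<open>u 0 0 w\<close>. For w =
  2n - 2 and w = 2n - 1 the entries fixed by apolarity and their mirror images are compatible, and
  only the moment identity is left to contradict a nonzero corner. This is a matter of numbers: for
  n = 4, w = 6 and d = 6 or 7 the identity to be refuted, \<open>y 0 = 2 * Z + y m\<close>, does
  hold. Hence the condition that n >= 6 or d + 3 <= 2n. With q = e_d - j and n = 2q + 2 the
  condition d < 2n reads d >= 4j - 2. This is the origin of N_s = 4s - 2 for s >= 3. For s = 2 the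
  exceptional pairs (n, d) = (4, 6), (4, 7) push the bound to 8, and for s = 1 it is the general d
  >= 4.\<close>

lemma binomial_times_diff:
  "(of_nat a - of_nat b) * of_nat (a choose i)
       = of_nat (Suc i) * of_nat (a choose Suc i) + (of_nat i - of_nat b) * (of_nat (a choose i) :: rat)"
proof -
  have "(of_nat a - of_nat i) * (of_nat (a choose i) :: rat) = of_nat (Suc i) * of_nat (a choose Suc i)"
  proof (cases "i \<le> a")
    case True
    have "Suc i * (a choose Suc i) = (a - i) * (a choose i)"
      by (metis binomial_absorb_comp binomial_absorption)
    then have "of_nat (Suc i * (a choose Suc i)) = (of_nat ((a - i) * (a choose i)) :: rat)"
      by simp
    then show ?thesis using True by (simp only: of_nat_mult of_nat_diff)
  qed (simp add: binomial_eq_0)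
  then show ?thesis by (simp add: algebra_simps)
qed

lemma binomial_Suc_rat:
  "of_nat (Suc i) * of_nat (a choose Suc i) = (of_nat a - of_nat i) * (of_nat (a choose i) :: rat)"
  using binomial_times_diff[of a i i] by simp

lemma binomial_Suc_quotient:
  "of_nat (a choose Suc i) = (of_nat a - of_nat i) * of_nat (a choose i) / (of_nat (Suc i) :: rat)"
  using binomial_Suc_rat[of i a] by (metis nonzero_mult_div_cancel_left of_nat_eq_0_iff nat.distinct(2))

text \<open>Binomials of order below \<open>N\<close> span the polynomials of degree below
  \<open>N\<close>, which separate \<open>N\<close> points. The induction multiplies
  \<open>p\<close> by \<open>a - A\<close>: this removes the left endpoint at the cost of one
  moment.\<close>

lemma binomial_moments_zero:
  fixes p :: "nat \<Rightarrow> rat"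
  assumes "\<And>i. i < N \<Longrightarrow> (\<Sum>a\<in>{A..<A+N}. of_nat (a choose i) * p a) = 0"
    and "a \<in> {A..<A+N}"
  shows "p a = 0"
  using assms
proof (induction N arbitrary: A p a)
  case 0
  then show ?case by simp
next
  case (Suc N)
  define p' where "p' a = (of_nat a - of_nat A) * p a" for a
  have ins: "{A..<A + Suc N} = insert A {Suc A..<Suc A + N}" by auto
  have "p' b = 0" if b: "b \<in> {Suc A..<Suc A + N}" for b
  proof (rule Suc.IH[OF _ b])
    fix i assume i: "i < N"
    have "(\<Sum>a\<in>{Suc A..<Suc A + N}. of_nat (a choose i) * p' a)
        = (\<Sum>a\<in>{A..<A + Suc N}. of_nat (a choose i) * p' a)"
      unfolding ins by (simp add: p'_def)
    also have "\<dots> = (\<Sum>a\<in>{A..<A + Suc N}. of_nat (Suc i) * (of_nat (a choose Suc i) * p a)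
        + (of_nat i - of_nat A) * (of_nat (a choose i) * p a))"
    proof (rule sum.cong)
      fix a
      have "of_nat (a choose i) * p' a = ((of_nat a - of_nat A) * of_nat (a choose i)) * p a"
        by (simp add: p'_def)
      then show "of_nat (a choose i) * p' a = of_nat (Suc i) * (of_nat (a choose Suc i) * p a)
        + (of_nat i - of_nat A) * (of_nat (a choose i) * p a)"
        unfolding binomial_times_diff by (simp add: algebra_simps)
    qed simp
    also have "\<dots> = 0"
      using Suc.prems(1)[of i] Suc.prems(1)[of "Suc i"] i
      by (simp only: sum.distrib sum_distrib_left[symmetric] mult_zero_right add_0_right Suc_less_eq less_SucI)
    finally show "(\<Sum>a\<in>{Suc A..<Suc A + N}. of_nat (a choose i) * p' a) = 0" .
  qed
  then have z: "p b = 0" if "b \<in> {Suc A..<Suc A + N}" for b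
    using that by (force simp: p'_def)
  have "p A = 0"
    using Suc.prems(1)[of 0] z unfolding ins by simp
  then show ?case using Suc.prems(2) z unfolding ins by blast
qed

text \<open>The hypothesis says that the form F with coefficients \<open>P i j k\<close> is killed
  by d/dx + d/dy + d/dz. Hence F(x, 0, z) = F(x - z, -z, 0), and the conclusion compares the
  coefficients of x^i z^(w - i).\<close>

lemma translation_invariant_moments:
  fixes P :: "nat \<Rightarrow> nat \<Rightarrow> nat \<Rightarrow> rat"
  assumes inv: "\<And>i j k. Suc (i + j + k) = w \<Longrightarrow>
      of_nat (Suc i) * P (Suc i) j k + of_nat (Suc j) * P i (Suc j) k
      + of_nat (Suc k) * P i j (Suc k) = 0"
    and "i \<le> w"
  shows "P i 0 (w - i) = (-1) ^ (w - i) * (\<Sum>a\<le>w. of_nat (a choose i) * P a (w - a) 0)"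
proof -
  \<comment> \<open>\<open>S k\<close> is the coefficient of x^i z^k in F(1 + x, 1, z) = F(1 + x -
    z, 1 - z, 0). By homogeneity the coefficient of x^i there is \<open>S 0\<close> times (1 - z)^(w
    - i), which is what the recursion \<open>step\<close> expresses.\<close>
  define S where "S k = (\<Sum>a\<le>w - k. of_nat (a choose i) * P a (w - k - a) k)" for k
  have step: "of_nat (Suc k) * S (Suc k) = - (of_nat (w - i) - of_nat k) * S k" if k: "k < w" for k
  proof -
    define m where "m = w - Suc k"
    have wk: "w - k = Suc m" using k by (simp add: m_def)
    have "0 = (\<Sum>a\<le>m. of_nat (a choose i) * (of_nat (Suc a) * P (Suc a) (m - a) k
        + of_nat (Suc (m - a)) * P a (Suc (m - a)) k + of_nat (Suc k) * P a (m - a) (Suc k)))"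
    proof (rule sum.neutral[symmetric], rule ballI)
      fix a assume "a \<in> {..m}"
      then have "Suc (a + (m - a) + k) = w" using k by (simp add: m_def)
      from inv[OF this] show "of_nat (a choose i) * (of_nat (Suc a) * P (Suc a) (m - a) k
        + of_nat (Suc (m - a)) * P a (Suc (m - a)) k + of_nat (Suc k) * P a (m - a) (Suc k)) = 0"
        by simp
    qed
    also have "\<dots> = (\<Sum>a\<le>m. of_nat (a choose i) * of_nat (Suc a) * P (Suc a) (m - a) k)
       + (\<Sum>a\<le>m. of_nat (a choose i) * of_nat (Suc m - a) * P a (Suc m - a) k)
       + of_nat (Suc k) * S (Suc k)"
      unfolding S_def m_def[symmetric] sum.distrib[symmetric] sum_distrib_left
      by (rule sum.cong) (simp_all add: algebra_simps Suc_diff_le)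
    also have "(\<Sum>a\<le>m. of_nat (a choose i) * of_nat (Suc a) * P (Suc a) (m - a) k)
        = (\<Sum>a\<le>Suc m. (of_nat a - of_nat i) * of_nat (a choose i) * P a (Suc m - a) k)"
    proof -
      have *: "of_nat (a choose i) * of_nat (Suc a) = (of_nat (Suc a) - of_nat i) * (of_nat (Suc a choose i) :: rat)" for a
      proof (cases i)
        case (Suc i')
        then show ?thesis
          using binomial_Suc_rat[of i' a] binomial_times_diff[of a i' i']
          by (simp add: algebra_simps)
      qed simp
      have z: "(of_nat (0::nat) - of_nat i) * (of_nat (0 choose i) :: rat) = 0"
        by (cases i) auto
      show ?thesis
        unfolding sum.atMost_Suc_shift * using z by simp
    qed
    also have "(\<Sum>a\<le>m. of_nat (a choose i) * of_nat (Suc m - a) * P a (Suc m - a) k)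
        = (\<Sum>a\<le>Suc m. of_nat (a choose i) * of_nat (Suc m - a) * P a (Suc m - a) k)"
      by simp
    also have "(\<Sum>a\<le>Suc m. (of_nat a - of_nat i) * of_nat (a choose i) * P a (Suc m - a) k)
      + (\<Sum>a\<le>Suc m. of_nat (a choose i) * of_nat (Suc m - a) * P a (Suc m - a) k)
      = (of_nat (w - i) - of_nat k) * S k"
    proof -
      have "of_nat (w - i) - of_nat k = (of_nat (Suc m) - of_nat i :: rat)"
        using assms(2) k by (simp add: m_def of_nat_diff Suc_diff_Suc)
      then show ?thesis
        unfolding S_def wk sum.distrib[symmetric] sum_distrib_left
        by (intro sum.cong) (simp_all only: atMost_iff of_nat_diff, simp_all only: algebra_simps)
    qed
    finally show ?thesis unfolding minus_mult_left[symmetric] by (simp only: eq_neg_iff_add_eq_0 add.commute)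
  qed
  have "S k = (-1) ^ k * of_nat ((w - i) choose k) * S 0" if "k \<le> w" for k
    using that
  proof (induction k)
    case (Suc k)
    have "of_nat (Suc k) * S (Suc k) = - (of_nat (w - i) - of_nat k) * S k"
      using step[of k] Suc.prems by simp
    also have "\<dots> = (-1) ^ Suc k * ((of_nat (w - i) - of_nat k) * of_nat ((w - i) choose k)) * S 0"
      using Suc by (simp add: algebra_simps)
    also have "\<dots> = of_nat (Suc k) * ((-1) ^ Suc k * of_nat ((w - i) choose Suc k) * S 0)"
      unfolding binomial_Suc_rat[symmetric] by simp
    finally show ?case
      by (simp only: mult_cancel_left of_nat_eq_0_iff) simp
  qed simp
  from this[of "w - i"] have "S (w - i) = (-1) ^ (w - i) * S 0" by simp
  moreover have "S (w - i) = P i 0 (w - i)"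
  proof -
    have "S (w - i) = (\<Sum>a\<le>i. if a = i then P i 0 (w - i) else 0)"
      unfolding S_def using \<open>i \<le> w\<close> by (intro sum.cong) (auto simp: binomial_eq_0)
    then show ?thesis by simp
  qed
  ultimately show ?thesis by (simp add: S_def)
qed

text \<open>Leibniz's estimate; peeling off the first term leaves a sum of the same kind with the
  opposite sign.\<close>

lemma alternating_sum_bounds:
  fixes g :: "nat \<Rightarrow> 'a::linordered_idom"
  assumes "\<And>i. i < L \<Longrightarrow> 0 \<le> g i" and "\<And>i. Suc i < L \<Longrightarrow> g (Suc i) \<le> g i"
  shows "0 \<le> (\<Sum>i<L. (-1) ^ i * g i) \<and> (0 < L \<longrightarrow> (\<Sum>i<L. (-1) ^ i * g i) \<le> g 0)"
  using assms
proof (induction L arbitrary: g)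
  case (Suc L)
  have "(\<Sum>i<Suc L. (-1) ^ i * g i) = g 0 - (\<Sum>i<L. (-1) ^ i * g (Suc i))"
    unfolding sum.lessThan_Suc_shift by (simp add: sum_negf)
  moreover have "0 \<le> (\<Sum>i<L. (-1) ^ i * g (Suc i)) \<and> (0 < L \<longrightarrow> (\<Sum>i<L. (-1) ^ i * g (Suc i)) \<le> g (Suc 0))"
    by (rule Suc.IH) (use Suc.prems in auto)
  moreover have "0 < L \<longrightarrow> g (Suc 0) \<le> g 0" using Suc.prems(2)[of 0] by auto
  moreover have "0 \<le> g 0" using Suc.prems(1)[of 0] by auto
  ultimately show ?case by (cases "L = 0") auto
qed simp


text \<open>For d = w = 2m the quotient of the square by the other binomial is the middle slice
  term. The bound 5 is sharp: m = 4 would require 5460 <= 4900.\<close>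

lemma central_binomial_ge:
  "5 \<le> m \<Longrightarrow> 3 * of_nat ((4 * m) choose m) \<le> (of_nat ((2 * m) choose m) :: rat)\<^sup>2"
proof (induction m rule: dec_induct)
  case base
  have "(20::nat) choose 5 = 15504" "(10::nat) choose 5 = 252"
    by (simp_all add: binomial_code fold_atLeastAtMost_nat.simps fact_numeral)
  then show ?case by simp
next
  case (step m)
  define X Y X' Y' M :: rat where "X = of_nat ((2 * m) choose m)" and "Y = of_nat ((4 * m) choose m)"
    and "X' = of_nat ((2 * Suc m) choose Suc m)" and "Y' = of_nat ((4 * Suc m) choose Suc m)"
    and "M = of_nat m"
  have M: "M \<ge> 0" by (simp add: M_def)
  have e1: "2 * Suc m = Suc (Suc (2 * m))" "4 * Suc m = Suc (Suc (Suc (Suc (4 * m))))"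
    "Suc (Suc (2 * m)) - Suc m = Suc m" "2 * m - m = m" "4 * m - m = 3 * m"
    "Suc (Suc (Suc (Suc (4 * m)))) - Suc m = Suc (Suc (Suc (3 * m)))" by simp_all
  define f where "f = (fact m :: rat)"
  have f: "f \<noteq> 0" "M + 1 \<noteq> 0" using M by (simp_all add: f_def)
  have fS: "fact (Suc m) = (M + 1) * f" by (simp add: f_def M_def)
  have "X' = ((2 * M + 2) * (2 * M + 1) * fact (2 * m)) / (((M + 1) * f) * ((M + 1) * f))"
    unfolding X'_def e1 by (subst binomial_fact) (simp_all add: e1(3) fS M_def del: fact_Suc, simp add: algebra_simps)
  moreover have X: "X = fact (2 * m) / (f * f)"
    unfolding X_def f_def by (subst binomial_fact) (simp_all add: e1)
  ultimately have "((M + 1) * f * f) * (X' * (M + 1)) = ((M + 1) * f * f) * (2 * (2 * M + 1) * X)"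
    using f by simp (simp add: algebra_simps)
  then have X': "X' * (M + 1) = 2 * (2 * M + 1) * X"
    using f by simp
  define g where "g = (fact (3 * m) :: rat)"
  have g: "g \<noteq> 0" "3 * M + 3 \<noteq> 0" "3 * M + 2 \<noteq> 0" "3 * M + 1 \<noteq> 0" using M by (simp_all add: g_def)
  have gS: "fact (Suc (Suc (Suc (3 * m)))) = (3 * M + 3) * (3 * M + 2) * (3 * M + 1) * g"
    by (simp add: g_def M_def algebra_simps)
  have "3 * m + 3 = Suc (Suc (Suc (3 * m)))" by simp
  then have gS': "fact (3 * m + 3) = (3 * M + 3) * (3 * M + 2) * (3 * M + 1) * g" by (simp only: gS)
  have hS: "fact (Suc (Suc (Suc (Suc (4 * m))))) = (4 * M + 4) * (4 * M + 3) * (4 * M + 2) * (4 * M + 1) * (fact (4 * m) :: rat)"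
    by (simp add: M_def algebra_simps)
  have "Y' = ((4 * M + 4) * (4 * M + 3) * (4 * M + 2) * (4 * M + 1) * fact (4 * m))
      / ((M + 1) * f * ((3 * M + 3) * (3 * M + 2) * (3 * M + 1) * g))"
    unfolding Y'_def e1 by (subst binomial_fact) (simp_all add: e1(6) fS gS gS' hS del: fact_Suc)
  moreover have "Y = fact (4 * m) / (f * g)"
    unfolding Y_def f_def g_def by (subst binomial_fact) (simp_all add: e1)
  ultimately have Y': "Y' * ((M + 1) * ((3 * M + 3) * (3 * M + 2) * (3 * M + 1)))
     = (4 * M + 4) * (4 * M + 3) * (4 * M + 2) * (4 * M + 1) * Y"
    using f g by (simp only: times_divide_eq_right times_divide_eq_left) (simp add: nonzero_divide_eq_eq nonzero_eq_divide_eq)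
  \<comment> \<open>The growth factors of \<open>X\<close> and \<open>Y\<close> from m to m + 1. The
    difference of \<open>t\<close> squared and \<open>r\<close> has a numerator with positive
    coefficients in \<open>M\<close>.\<close>
  define t r where "t = 2 * (2 * M + 1) / (M + 1)"
    and "r = (4 * M + 4) * (4 * M + 3) * (4 * M + 2) * (4 * M + 1)
      / ((M + 1) * ((3 * M + 3) * (3 * M + 2) * (3 * M + 1)))"
  have "X' = t * X" using X' M by (simp add: t_def field_simps)
  have pos: "(M + 1) * ((3 * M + 3) * (3 * M + 2) * (3 * M + 1)) > 0" using M by simp
  have "Y' = r * Y" unfolding r_def times_divide_eq_left using Y' pos by (metis less_irrefl nonzero_eq_divide_eq)
  have r: "r = 8 * (4 * M + 3) * (2 * M + 1) * (4 * M + 1) / (3 * (M + 1) * (3 * M + 2) * (3 * M + 1))"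
    unfolding r_def using M
    by (simp add: divide_simps add_nonneg_eq_0_iff) (simp add: algebra_simps)
  have "t\<^sup>2 - r = (4 * (2 * M + 1)) * (22 * M ^ 3 + 17 * M ^ 2 + M)
       / (3 * (M + 1)\<^sup>2 * (3 * M + 2) * (3 * M + 1))"
    unfolding r t_def using M
    by (simp add: divide_simps add_nonneg_eq_0_iff) (simp add: algebra_simps power2_eq_square power3_eq_cube)
  also have "\<dots> \<ge> 0" using M by simp
  finally have "r \<le> t\<^sup>2" by simp
  have "3 * Y \<le> X\<^sup>2" using step.IH by (simp add: X_def Y_def)
  have "3 * Y' = r * (3 * Y)" by (simp add: \<open>Y' = r * Y\<close>)
  also have "\<dots> \<le> t\<^sup>2 * (3 * Y)"
    using \<open>r \<le> t\<^sup>2\<close> by (rule mult_right_mono) (simp add: Y_def)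
  also have "\<dots> \<le> t\<^sup>2 * X\<^sup>2"
    using \<open>3 * Y \<le> X\<^sup>2\<close> by (rule mult_left_mono) simp
  finally show ?case
    by (simp only: \<open>X' = t * X\<close> power_mult_distrib flip: X'_def Y'_def)
qed

subsection \<open>Hypergeometric terms\<close>

text \<open>The factor \<open>c\<close> such that \<open>u i j k = c\<close> for \<open>i + j = r\<close>, when \<open>u\<close> is killed by the raising operator and
  \<open>u 0 0 w = 1\<close>; the sign is split off.\<close>
fun slice_coeff :: "nat \<Rightarrow> nat \<Rightarrow> nat \<Rightarrow> rat" where
  "slice_coeff d w 0 = 1"
| "slice_coeff d w (Suc r) = (of_nat d - of_nat w + of_nat (Suc r)) / (2 * of_nat d - of_nat r) * slice_coeff d w r"

text \<open>Up to sign, the entry \<open>P a (w - a) 0\<close> of the weighted array introduced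
  below when \<open>u 0 0 w = 1\<close> and \<open>a < n\<close>.\<close>

definition slice_term :: "nat \<Rightarrow> nat \<Rightarrow> nat \<Rightarrow> rat" where
  "slice_term d w a = of_nat (d choose a) * of_nat (d choose (w - a)) * slice_coeff d w a"

lemma slice_coeff_Suc:
  assumes "Suc r \<le> 2 * d"
  shows "(2 * of_nat d - of_nat r) * slice_coeff d w (Suc r)
    = (of_nat d - of_nat w + of_nat (Suc r)) * slice_coeff d w r"
proof -
  have "of_nat r < (of_nat (2 * d) :: rat)" using assms by (simp only: of_nat_less_iff)
  then show ?thesis by simp
qed

lemma slice_coeff_pos:
  assumes "w \<le> d" "r \<le> w"
  shows "slice_coeff d w r > 0"
  using assms(2)
proof (induction r)
  case (Suc r)
  have "of_nat w \<le> (of_nat d :: rat)" "of_nat (Suc r) \<le> (of_nat d :: rat)"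
    using Suc.prems assms(1) by (simp_all only: of_nat_le_iff)
  then have "of_nat d - of_nat w + of_nat (Suc r) > (0::rat)" "2 * of_nat d - of_nat r > (0::rat)"
    by (auto intro: add_nonneg_pos)
  then show ?case using Suc by simp
qed simp

lemma slice_coeff_strict_decreasing:
  assumes "w \<le> d" "Suc r \<le> w"
  shows "slice_coeff d w (Suc r) < slice_coeff d w r"
proof -
  have w: "of_nat w \<le> (of_nat d :: rat)" "of_nat (Suc r) \<le> (of_nat w :: rat)"
    using assms by (simp_all only: of_nat_le_iff)
  then have "(of_nat d - of_nat w + of_nat (Suc r)) / (2 * of_nat d - of_nat r) < (1::rat)"
    by (simp add: divide_less_eq)
  then show ?thesis
    using mult_strict_right_mono[OF _ slice_coeff_pos[of w d r], of _ 1] assms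
    unfolding slice_coeff.simps by (metis Suc_leD mult_1)
qed

lemma slice_coeff_less:
  assumes "w \<le> d" "l \<le> w" "k < l"
  shows "slice_coeff d w l < slice_coeff d w k"
  using assms(3,2)
proof (induction l)
  case (Suc l)
  then show ?case
    using slice_coeff_strict_decreasing[OF assms(1), of l]
    by (cases "k = l") (auto dest: less_trans)
qed simp

lemma slice_term_Suc:
  assumes "w \<le> d" "a < w"
  shows "of_nat (Suc a) * (2 * of_nat d - of_nat a) * slice_term d w (Suc a)
    = (of_nat d - of_nat a) * (of_nat w - of_nat a) * slice_term d w a"
proof -
  define b where "b = w - Suc a"
  have b: "w - a = Suc b" "w - Suc a = b" "of_nat w = (of_nat a + of_nat b + 1 :: rat)"
    using assms by (simp_all add: b_def Suc_diff_Suc of_nat_diff)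
  have 1: "of_nat (Suc b) * of_nat (d choose Suc b) = (of_nat d - of_nat b) * (of_nat (d choose b) :: rat)"
    by (rule binomial_Suc_rat)
  have 2: "of_nat (Suc a) * of_nat (d choose Suc a) = (of_nat d - of_nat a) * (of_nat (d choose a) :: rat)"
    by (rule binomial_Suc_rat)
  have 3: "(2 * of_nat d - of_nat a) * slice_coeff d w (Suc a) = (of_nat d - of_nat b) * slice_coeff d w a"
    using slice_coeff_Suc[of a d w] assms by (simp add: b(3) del: slice_coeff.simps)
  have "of_nat (Suc a) * (2 * of_nat d - of_nat a) * slice_term d w (Suc a)
     = (of_nat (Suc a) * of_nat (d choose Suc a)) * ((2 * of_nat d - of_nat a) * slice_coeff d w (Suc a)) * of_nat (d choose b)"
    by (simp add: slice_term_def b mult_ac del: slice_coeff.simps of_nat_Suc)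
  also have "\<dots> = (of_nat d - of_nat a) * of_nat (d choose a) * slice_coeff d w a * ((of_nat d - of_nat b) * of_nat (d choose b))"
    unfolding 2 3 by (simp only: mult_ac)
  also have "\<dots> = (of_nat d - of_nat a) * (of_nat w - of_nat a) * slice_term d w a"
    unfolding 1[symmetric] slice_term_def b(1) by (simp add: b(3) algebra_simps)
  finally show ?thesis .
qed

lemma slice_term_nonneg:
  assumes "w \<le> d" "a \<le> w"
  shows "0 \<le> slice_term d w a"
  using slice_coeff_pos[OF assms] by (simp add: slice_term_def)

text \<open>From the middle index on both factors of the quotient of consecutive terms are at most
  one: d - a <= a + 1 and w - a <= 2d - a.\<close>

lemma slice_term_decreasing:
  assumes "w \<le> d" "a < w" "d \<le> 2 * a + 1"
  shows "slice_term d w (Suc a) \<le> slice_term d w a"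
proof -
  have r: "of_nat a < (of_nat w :: rat)" "of_nat w \<le> (of_nat d :: rat)" "of_nat d \<le> (of_nat (2 * a + 1) :: rat)"
    using assms by (simp_all only: of_nat_le_iff of_nat_less_iff)
  have "(of_nat d - of_nat a) * (of_nat w - of_nat a) * slice_term d w a
     \<le> of_nat (Suc a) * (2 * of_nat d - of_nat a) * slice_term d w a"
    using r assms by (intro mult_right_mono mult_mono slice_term_nonneg) auto
  then have "of_nat (Suc a) * (2 * of_nat d - of_nat a) * slice_term d w (Suc a)
     \<le> of_nat (Suc a) * (2 * of_nat d - of_nat a) * slice_term d w a"
    unfolding slice_term_Suc[OF assms(1,2)] .
  moreover have "0 < of_nat (Suc a) * (2 * of_nat d - of_nat a :: rat)"
    using r by (intro mult_pos_pos) auto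
  ultimately show ?thesis by (simp only: mult_le_cancel_left_pos)
qed

text \<open>Both sides satisfy the same first order recursion in \<open>a\<close>. The product form
  makes the middle terms comparable with central binomials.\<close>

lemma slice_term_closed_form:
  assumes "w \<le> d" "a \<le> w"
  shows "slice_term d w a * of_nat ((2 * d) choose a)
    = of_nat (d choose w) * of_nat (d choose a) * of_nat (w choose a)"
  using assms(2)
proof (induction a)
  case (Suc a)
  have r: "of_nat a < (of_nat (2 * d) :: rat)"
    using Suc.prems assms by (simp only: of_nat_le_iff of_nat_less_iff)
  have 1: "of_nat (Suc a) * of_nat (d choose Suc a) = (of_nat d - of_nat a) * (of_nat (d choose a) :: rat)"
    and 2: "of_nat (Suc a) * of_nat (w choose Suc a) = (of_nat w - of_nat a) * (of_nat (w choose a) :: rat)"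
    and 3: "of_nat (Suc a) * of_nat ((2 * d) choose Suc a) = (2 * of_nat d - of_nat a) * (of_nat ((2 * d) choose a) :: rat)"
    using binomial_Suc_rat[of a d] binomial_Suc_rat[of a w] binomial_Suc_rat[of a "2 * d"] by simp_all
  have "(of_nat (Suc a) * (2 * of_nat d - of_nat a)) * of_nat (Suc a) * (slice_term d w (Suc a) * of_nat ((2 * d) choose Suc a))
     = (of_nat (Suc a) * (2 * of_nat d - of_nat a) * slice_term d w (Suc a)) * (of_nat (Suc a) * of_nat ((2 * d) choose Suc a))"
    by (simp only: mult_ac)
  also have "\<dots> = (2 * of_nat d - of_nat a) * ((of_nat d - of_nat a) * (of_nat w - of_nat a)) * (slice_term d w a * of_nat ((2 * d) choose a))"
    using Suc.prems unfolding 3 by (subst slice_term_Suc[OF assms(1)]) (simp_all only: Suc_le_eq mult_ac)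
  also have "\<dots> = (2 * of_nat d - of_nat a) * (of_nat (d choose w) * ((of_nat d - of_nat a) * of_nat (d choose a)) * ((of_nat w - of_nat a) * of_nat (w choose a)))"
    using Suc by (simp only: Suc_leD mult_ac)
  also have "\<dots> = (of_nat (Suc a) * (2 * of_nat d - of_nat a)) * of_nat (Suc a)
     * (of_nat (d choose w) * of_nat (d choose Suc a) * of_nat (w choose Suc a))"
    unfolding 1[symmetric] 2[symmetric] by (simp only: mult_ac)
  finally show ?case
    using r by (subst (asm) mult_left_cancel) (auto simp del: of_nat_Suc)
qed (simp add: slice_term_def)

text \<open>This evaluates the moment identity on the trilinear form that is constant on the slices of one pair of
  indices.\<close>
lemma slice_term_alternating_sum:
  assumes "w \<le> d"
  shows "(\<Sum>a\<le>w. (-1) ^ a * slice_term d w a) = slice_term d w w"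
proof -
  \<comment> \<open>The slices are taken in \<open>i + k\<close>: then \<open>k = 0\<close> yields
    every term with its sign, and \<open>i = j = 0\<close> only the last one.\<close>
  define P :: "nat \<Rightarrow> nat \<Rightarrow> nat \<Rightarrow> rat" where
    "P i j k = of_nat (d choose i) * of_nat (d choose j) * of_nat (d choose k) * ((-1) ^ (i + k) * slice_coeff d w (i + k))"
    for i j k
  have "P 0 0 (w - 0) = (-1) ^ (w - 0) * (\<Sum>a\<le>w. of_nat (a choose 0) * P a (w - a) 0)"
  proof (rule translation_invariant_moments)
    fix i j k assume w: "Suc (i + j + k) = w"
    define c where "c = of_nat (d choose i) * of_nat (d choose j) * of_nat (d choose k) * ((-1) ^ (i + k) :: rat)"
    have "of_nat (Suc i) * P (Suc i) j k = - c * (of_nat d - of_nat i) * slice_coeff d w (Suc (i + k))"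
      unfolding P_def c_def by (simp add: binomial_Suc_quotient mult_ac del: of_nat_Suc slice_coeff.simps)
    moreover have "of_nat (Suc j) * P i (Suc j) k = c * (of_nat d - of_nat j) * slice_coeff d w (i + k)"
      unfolding P_def c_def by (simp add: binomial_Suc_quotient mult_ac del: of_nat_Suc slice_coeff.simps)
    moreover have "of_nat (Suc k) * P i j (Suc k) = - c * (of_nat d - of_nat k) * slice_coeff d w (Suc (i + k))"
      unfolding P_def c_def by (simp add: binomial_Suc_quotient mult_ac del: of_nat_Suc slice_coeff.simps)
    moreover have "c * ((2 * of_nat d - of_nat i - of_nat k) * slice_coeff d w (Suc (i + k)))
      = c * ((of_nat d - of_nat j) * slice_coeff d w (i + k))"
    proof -
      have "(2 * of_nat d - of_nat i - of_nat k) * slice_coeff d w (Suc (i + k)) = (of_nat d - of_nat j) * slice_coeff d w (i + k)"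
      proof -
      have "of_nat d - of_nat w + of_nat (Suc (i + k)) = (of_nat d - of_nat j :: rat)"
        unfolding w[symmetric] by simp
      then show ?thesis
        using slice_coeff_Suc[of "i + k" d w] w assms by (simp add: diff_diff_add del: slice_coeff.simps)
      qed
      then show ?thesis by (simp only:)
    qed
    ultimately show "of_nat (Suc i) * P (Suc i) j k + of_nat (Suc j) * P i (Suc j) k + of_nat (Suc k) * P i j (Suc k) = 0"
      by (simp only:) (simp add: algebra_simps del: slice_coeff.simps)
  qed simp
  moreover have "P 0 0 w = (-1) ^ w * slice_term d w w" by (simp add: P_def slice_term_def)
  ultimately have "(-1) ^ w * slice_term d w w = (-1) ^ w * (\<Sum>a\<le>w. P a (w - a) 0)" by simp
  then have "slice_term d w w = (\<Sum>a\<le>w. P a (w - a) 0)" by simp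
  also have "\<dots> = (\<Sum>a\<le>w. (-1) ^ a * slice_term d w a)"
    by (rule sum.cong) (simp_all add: P_def slice_term_def)
  finally show ?thesis ..
qed

text \<open>Adding w <= 2m and 2w <= 2d gives 3(w - m) <= 2d - m; together with d - m <= m + 1 the
  quotient of consecutive terms is at most 1/3.\<close>

lemma slice_term_third:
  assumes "w \<le> d" "d \<le> 2 * m + 1" "m < w" "w \<le> 2 * m"
  shows "3 * slice_term d w (Suc m) \<le> slice_term d w m"
proof -
  have r: "of_nat m < (of_nat w :: rat)" "of_nat w \<le> (of_nat d :: rat)" "of_nat d \<le> (of_nat (2 * m + 1) :: rat)"
     "of_nat w \<le> (of_nat (2 * m) :: rat)"
    using assms by (simp_all only: of_nat_le_iff of_nat_less_iff)
  have le: "3 * ((of_nat d - of_nat m) * (of_nat w - of_nat m)) \<le> of_nat (Suc m) * (2 * of_nat d - of_nat m :: rat)"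
  proof -
    have "(of_nat d - of_nat m) * (3 * (of_nat w - of_nat m)) \<le> (of_nat m + 1) * (2 * of_nat d - of_nat m :: rat)"
      using r by (intro mult_mono) auto
    then show ?thesis by (simp add: algebra_simps)
  qed
  have pos: "0 < of_nat (Suc m) * (2 * of_nat d - of_nat m :: rat)"
    using r by (intro mult_pos_pos) auto
  have "of_nat (Suc m) * (2 * of_nat d - of_nat m) * (3 * slice_term d w (Suc m))
    = 3 * ((of_nat d - of_nat m) * (of_nat w - of_nat m)) * slice_term d w m"
    using slice_term_Suc[OF assms(1,3)] by (simp only: mult_ac)
  also have "\<dots> \<le> of_nat (Suc m) * (2 * of_nat d - of_nat m) * slice_term d w m"
    using le by (rule mult_right_mono) (use assms in \<open>simp add: slice_term_nonneg\<close>)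
  finally show ?thesis using pos by (simp only: mult_le_cancel_left_pos)
qed

text \<open>For d = 2m this is \<open>central_binomial_ge\<close> in closed form. For d = 2m + 1
  absorption reduces the binomials to those of the even case, and the factors that remain differ by
  (2M + 1) M (M - 1).\<close>

lemma slice_term_peak_even:
  assumes "5 \<le> m" "d = 2 * m \<or> d = Suc (2 * m)"
  shows "3 * slice_term d (2 * m) 0 \<le> slice_term d (2 * m) m"
proof -
  define M X Y :: rat where "M = of_nat m" and "X = of_nat ((2 * m) choose m)" and "Y = of_nat ((4 * m) choose m)"
  have XY: "3 * Y \<le> X\<^sup>2" using central_binomial_ge[OF assms(1)] by (simp add: X_def Y_def)
  have M: "M \<ge> 5" using assms(1) by (simp add: M_def)
  have Y0: "Y > 0" by (simp add: Y_def)
  from assms(2) show ?thesis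
  proof
    assume d: "d = 2 * m"
    have "slice_term d (2 * m) m * Y = X * X"
      using slice_term_closed_form[of "2 * m" d m] d by (simp add: X_def Y_def)
    then have "3 * Y \<le> slice_term d (2 * m) m * Y" using XY by (simp add: power2_eq_square)
    then show ?thesis using Y0 d by (simp add: slice_term_def)
  next
    assume d: "d = Suc (2 * m)"
    define X' Y' :: rat where "X' = of_nat (Suc (2 * m) choose m)" and "Y' = of_nat ((4 * m + 2) choose m)"
    have 1: "slice_term d (2 * m) m * Y' = of_nat (d choose (2 * m)) * X' * X"
      using slice_term_closed_form[of "2 * m" d m] d by (simp add: X_def Y'_def X'_def)
    have X': "X' * (M + 1) = (2 * M + 1) * X"
    proof -
      have "Suc (2 * m) * (2 * m choose m) = (Suc (2 * m) - m) * (Suc (2 * m) choose m)"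
        by (metis binomial_absorb_comp diff_Suc_1 mult.commute)
      then have "(of_nat (Suc (2 * m) * (2 * m choose m)) :: rat) = of_nat ((Suc m) * (Suc (2 * m) choose m))"
        by (simp add: Suc_diff_le)
      then show ?thesis by (simp add: X'_def X_def M_def algebra_simps)
    qed
    have Y': "Y' * ((3 * M + 2) * (3 * M + 1)) = (4 * M + 2) * (4 * M + 1) * Y"
    proof -
      have "(Suc (Suc (4 * m)) - m) * (Suc (Suc (4 * m)) choose m) = Suc (Suc (4 * m)) * (Suc (4 * m) choose m)"
           "(Suc (4 * m) - m) * (Suc (4 * m) choose m) = Suc (4 * m) * (4 * m choose m)"
        by (metis binomial_absorb_comp diff_Suc_1)+
      then have *: "Suc (Suc (3 * m)) * (Suc (Suc (4 * m)) choose m) = Suc (Suc (4 * m)) * (Suc (4 * m) choose m)"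
           "Suc (3 * m) * (Suc (4 * m) choose m) = Suc (4 * m) * (4 * m choose m)"
        by (simp_all add: Suc_diff_le del: mult_Suc)
      have "(Suc (Suc (3 * m)) * Suc (3 * m)) * (Suc (Suc (4 * m)) choose m)
          = Suc (3 * m) * (Suc (Suc (3 * m)) * (Suc (Suc (4 * m)) choose m))" by (simp only: mult_ac)
      also have "\<dots> = Suc (Suc (4 * m)) * (Suc (3 * m) * (Suc (4 * m) choose m))" unfolding *(1) by (simp only: mult_ac)
      also have "\<dots> = (Suc (Suc (4 * m)) * Suc (4 * m)) * (4 * m choose m)" unfolding *(2) by (simp only: mult_ac)
      finally have "(of_nat ((Suc (Suc (3 * m)) * Suc (3 * m)) * (Suc (Suc (4 * m)) choose m)) :: rat)
          = of_nat ((Suc (Suc (4 * m)) * Suc (4 * m)) * (4 * m choose m))" by (simp only:)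
      then show ?thesis by (simp add: Y'_def Y_def M_def algebra_simps)
    qed
    have "3 * Y' \<le> X' * X"
    proof -
      have "(3 * Y') * ((M + 1) * ((3 * M + 2) * (3 * M + 1))) = ((M + 1) * (4 * M + 2) * (4 * M + 1)) * (3 * Y)"
        using arg_cong[OF Y', of "\<lambda>x. 3 * (M + 1) * x"] by (simp only: mult_ac)
      also have "\<dots> \<le> ((M + 1) * (4 * M + 2) * (4 * M + 1)) * X\<^sup>2"
        using XY by (rule mult_left_mono) (use M in auto)
      also have "\<dots> \<le> ((2 * M + 1) * (3 * M + 2) * (3 * M + 1)) * X\<^sup>2"
      proof (rule mult_right_mono)
        have "(2 * M + 1) * (3 * M + 2) * (3 * M + 1) - (M + 1) * (4 * M + 2) * (4 * M + 1)
            = (2 * M + 1) * (M * (M - 1))" by (simp add: algebra_simps)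
        also have "\<dots> \<ge> 0" using M by simp
        finally show "(M + 1) * (4 * M + 2) * (4 * M + 1) \<le> (2 * M + 1) * (3 * M + 2) * (3 * M + 1)" by simp
      qed simp
      also have "\<dots> = ((2 * M + 1) * X) * X * ((3 * M + 2) * (3 * M + 1))" by (simp add: power2_eq_square)
      also have "\<dots> = (X' * X) * ((M + 1) * ((3 * M + 2) * (3 * M + 1)))"
        unfolding X'[symmetric] by simp
      finally show ?thesis using M by (subst (asm) mult_le_cancel_right_pos) auto
    qed
    then have "of_nat (d choose (2 * m)) * (3 * Y') \<le> of_nat (d choose (2 * m)) * (X' * X)"
      by (rule mult_left_mono) simp
    then have "(3 * of_nat (d choose (2 * m))) * Y' \<le> slice_term d (2 * m) m * Y'"
      unfolding 1 by (simp add: mult_ac)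
    moreover have "Y' > 0" by (simp add: Y'_def)
    ultimately show ?thesis by (simp add: slice_term_def)
  qed
qed

text \<open>The margin is wide: the term at m + 1 is at least 33/17, the value at m = 5 of an
  increasing bound, and the next one is at most a third of it. So the right side is at least 44/17,
  while the last term is at most 1/10.\<close>

lemma slice_term_peak_odd:
  assumes "5 \<le> m"
  defines "d \<equiv> Suc (2 * m)"
  shows "1 + 2 * slice_term d d d < 2 * (slice_term d d (Suc m) - slice_term d d (Suc (Suc m)))"
proof -
  define M X Y :: rat where "M = of_nat m" and "X = of_nat (Suc (2 * m) choose m)" and "Y = of_nat ((4 * m + 2) choose m)"
  have M: "M \<ge> 5" using assms(1) by (simp add: M_def)
  have Y0: "Y > 0" by (simp add: Y_def)
  have dM: "of_nat d = 2 * M + 1" by (simp add: d_def M_def)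
  have "slice_term d d m * Y = X * X"
    using slice_term_closed_form[of d d m] by (simp add: d_def X_def Y_def)
  \<comment> \<open>The factor (2M + 1)/(M + 1) turns \<open>2 * m choose m\<close> into
    \<open>X\<close>, which carries the estimate for w = 2m over to w = d.\<close>
  moreover have "3 * Y * ((2 * M + 1) / (M + 1)) \<le> X * X"
  proof -
    have "3 * slice_term d (2 * m) 0 \<le> slice_term d (2 * m) m"
      by (rule slice_term_peak_even) (simp_all add: d_def assms(1))
    then have "3 * of_nat (d choose (2 * m)) * Y \<le> slice_term d (2 * m) m * Y"
      using Y0 by (simp add: slice_term_def)
    also have "\<dots> = of_nat (d choose (2 * m)) * X * of_nat (2 * m choose m)"
      using slice_term_closed_form[of "2 * m" d m] by (simp add: d_def X_def Y_def)
    finally have "of_nat (d choose (2 * m)) * (3 * Y) \<le> of_nat (d choose (2 * m)) * (X * of_nat (2 * m choose m))"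
      by (simp add: mult_ac)
    then have 1: "3 * Y \<le> X * of_nat (2 * m choose m)"
      by (subst (asm) mult_le_cancel_left_pos) (auto simp: d_def)
    have "Suc (2 * m) * (2 * m choose m) = (Suc (2 * m) - m) * (Suc (2 * m) choose m)"
      by (metis binomial_absorb_comp diff_Suc_1 mult.commute)
    then have "(of_nat (Suc (2 * m) * (2 * m choose m)) :: rat) = of_nat ((Suc m) * (Suc (2 * m) choose m))"
      by (simp add: Suc_diff_le)
    then have "(2 * M + 1) * of_nat (2 * m choose m) = (M + 1) * X"
      by (simp add: X_def M_def algebra_simps)
    then have 2: "of_nat (2 * m choose m) * ((2 * M + 1) / (M + 1)) = X"
      using M by (simp add: field_simps)
    have "3 * Y * ((2 * M + 1) / (M + 1)) \<le> X * of_nat (2 * m choose m) * ((2 * M + 1) / (M + 1))"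
      using 1 by (rule mult_right_mono) (use M in simp)
    then show ?thesis by (simp only: mult.assoc 2)
  qed
  ultimately have "(3 * ((2 * M + 1) / (M + 1))) * Y \<le> slice_term d d m * Y" by (simp add: mult_ac)
  then have ym: "3 * ((2 * M + 1) / (M + 1)) \<le> slice_term d d m" using Y0 by (simp only: mult_le_cancel_right_pos)
  have "of_nat (Suc m) * (2 * of_nat d - of_nat m) * slice_term d d (Suc m)
      = (of_nat d - of_nat m) * (of_nat d - of_nat m) * slice_term d d m"
    by (rule slice_term_Suc) (simp_all add: d_def)
  then have "(M + 1) * ((3 * M + 2) * slice_term d d (Suc m)) = (M + 1) * ((M + 1) * slice_term d d m)"
    unfolding dM M_def[symmetric] of_nat_Suc by (simp add: algebra_simps)
  then have s1: "(3 * M + 2) * slice_term d d (Suc m) = (M + 1) * slice_term d d m" using M by simp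
  have "3 * (2 * M + 1) \<le> (M + 1) * slice_term d d m"
    using ym M by (simp add: field_simps)
  then have a1: "3 * (2 * M + 1) / (3 * M + 2) \<le> slice_term d d (Suc m)"
    unfolding s1[symmetric] using M by (simp add: divide_le_eq mult.commute)
  have "33/17 \<le> 3 * (2 * M + 1) / (3 * M + 2)" using M by (simp add: field_simps)
  from order.trans[OF this a1] have y1: "33/17 \<le> slice_term d d (Suc m)" .
  have "of_nat (Suc (Suc m)) * (2 * of_nat d - of_nat (Suc m)) * slice_term d d (Suc (Suc m))
      = (of_nat d - of_nat (Suc m)) * (of_nat d - of_nat (Suc m)) * slice_term d d (Suc m)"
    by (rule slice_term_Suc) (use assms(1) in \<open>simp_all add: d_def\<close>)
  then have s2: "(M + 2) * (3 * M + 1) * slice_term d d (Suc (Suc m)) = M * M * slice_term d d (Suc m)"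
    unfolding dM M_def[symmetric] of_nat_Suc by (simp add: algebra_simps)
  have y2: "3 * slice_term d d (Suc (Suc m)) \<le> slice_term d d (Suc m)"
  proof -
    have "3 * (M * M) * slice_term d d (Suc m) \<le> ((M + 2) * (3 * M + 1)) * slice_term d d (Suc m)"
      by (rule mult_right_mono) (use M y1 in \<open>auto simp: algebra_simps\<close>)
    then have "((M + 2) * (3 * M + 1)) * (3 * slice_term d d (Suc (Suc m))) \<le> ((M + 2) * (3 * M + 1)) * slice_term d d (Suc m)"
      using s2 by (simp add: mult_ac)
    then show ?thesis using M by (subst (asm) mult_le_cancel_left_pos) auto
  qed
  have "10 \<le> (2 * d choose 1)" using assms(1) by (simp add: d_def)
  also have "\<dots> \<le> 2 * d choose d" by (rule binomial_maximum')
  finally have "(of_nat 10 :: rat) \<le> of_nat (2 * d choose d)" by (simp only: of_nat_le_iff)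
  moreover have "slice_term d d d * of_nat (2 * d choose d) = 1"
    using slice_term_closed_form[of d d d] by simp
  moreover have "slice_term d d d \<ge> 0" by (rule slice_term_nonneg) simp_all
  ultimately have "slice_term d d d * 10 \<le> 1"
    by (metis mult_left_mono of_nat_numeral)
  then show ?thesis using y1 y2 by simp
qed

subsection \<open>Trilinear forms killed by raising\<close>

text \<open>\<open>apolar\<close> is the component \<open>s = 0\<close> of a transvectant, which is
  all that \<open>slice_value\<close> uses; \<open>inv\<close> says that raising kills the part of
  weight \<open>w\<close>.\<close>

locale invariant_trilinear =
  fixes d n w :: nat and u :: "nat \<Rightarrow> nat \<Rightarrow> nat \<Rightarrow> rat"
  assumes sym12: "u i j k = u j i k" and sym23: "u i j k = u i k j"
    and out: "d < i \<Longrightarrow> u i j k = 0"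
    and apolar: "even r \<Longrightarrow> 0 < r \<Longrightarrow> r < n \<Longrightarrow> (\<Sum>i\<le>r. (-1) ^ i * of_nat (r choose i) * u i (r - i) k) = 0"
    and inv: "Suc (i + j + k) = w \<Longrightarrow> (of_nat d - of_nat i) * u (Suc i) j k
        + (of_nat d - of_nat j) * u i (Suc j) k + (of_nat d - of_nat k) * u i j (Suc k) = 0"
    and n_le: "n \<le> d" and d_less: "d < 2 * n" and even_n: "even n" and w_pos: "0 < w"
    and large: "6 \<le> n \<or> d + 3 \<le> 2 * n"
begin

text \<open>On each slice the invariance is a first order recursion for the deviation from the
  expected constant, and successive deviations have opposite signs. On an even slice such a
  deviation is not apolar, on an odd one it is not symmetric, unless it vanishes.\<close>

lemma slice_value:
  assumes "r < n" "r \<le> w" "i \<le> r"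
  shows "u i (r - i) (w - r) = (-1) ^ r * slice_coeff d w r * u 0 0 w"
  using assms
proof (induction r arbitrary: i)
  case (Suc r)
  define c where "c = (-1) ^ Suc r * slice_coeff d w (Suc r) * u 0 0 w"
  define e where "e i = u i (Suc r - i) (w - Suc r) - c" for i
  have rd: "Suc r < d" using Suc.prems n_le by simp
  have step: "(of_nat d - of_nat i) * e (Suc i) = - (of_nat d - of_nat (r - i)) * e i" if i: "i \<le> r" for i
  proof -
    have "Suc (i + (r - i) + (w - Suc r)) = w" using i Suc.prems by simp
    from inv[OF this] have 1: "(of_nat d - of_nat i) * u (Suc i) (r - i) (w - Suc r)
      + (of_nat d - of_nat (r - i)) * u i (Suc r - i) (w - Suc r)
      + (of_nat d - of_nat (w - Suc r)) * u i (r - i) (w - r) = 0"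
      using i Suc.prems by (simp add: Suc_diff_le Suc_diff_Suc)
    have 2: "u i (r - i) (w - r) = (-1) ^ r * slice_coeff d w r * u 0 0 w"
      using Suc.IH Suc.prems i by simp
    have wr: "of_nat d - of_nat (w - Suc r) = (of_nat d - of_nat w + of_nat (Suc r) :: rat)"
      using Suc.prems by (simp add: of_nat_diff)
    have "((2 * of_nat d - of_nat r) * slice_coeff d w (Suc r)) * ((-1) ^ r * u 0 0 w)
      = ((of_nat d - of_nat w + of_nat (Suc r)) * slice_coeff d w r) * ((-1) ^ r * u 0 0 w)"
      using slice_coeff_Suc[of r d w] rd by simp
    then have 3: "(of_nat d - of_nat (w - Suc r)) * u i (r - i) (w - r) = - (2 * of_nat d - of_nat r) * c"
      unfolding 2 wr c_def by (simp add: algebra_simps del: slice_coeff.simps of_nat_Suc)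
    have ri: "of_nat (r - i) = (of_nat r - of_nat i :: rat)" using i by (simp add: of_nat_diff)
    show ?thesis
      using 1 unfolding 3 e_def ri by (simp add: algebra_simps)
  qed
  have "\<exists>\<rho>>0. e i = (-1) ^ i * \<rho> * e 0" if "i \<le> Suc r" for i
    using that
  proof (induction i)
    case 0
    show ?case by (rule exI[of _ 1]) simp
  next
    case (Suc i)
    then obtain \<rho> where \<rho>: "\<rho> > 0" "e i = (-1) ^ i * \<rho> * e 0" by auto
    have "of_nat i < (of_nat d :: rat)" "of_nat (r - i) < (of_nat d :: rat)"
      using Suc.prems rd by simp_all
    then have pos: "of_nat d - of_nat i > (0 :: rat)" "of_nat d - of_nat (r - i) > (0 :: rat)" by simp_all
    have "e (Suc i) = - (of_nat d - of_nat (r - i)) * e i / (of_nat d - of_nat i)"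
      using step[of i] Suc.prems pos by (simp add: eq_divide_eq mult.commute)
    also have "\<dots> = (-1) ^ Suc i * ((of_nat d - of_nat (r - i)) / (of_nat d - of_nat i) * \<rho>) * e 0"
      unfolding \<rho>(2) by (simp add: algebra_simps diff_divide_distrib)
    finally have "e (Suc i) = (-1) ^ Suc i * ((of_nat d - of_nat (r - i)) / (of_nat d - of_nat i) * \<rho>) * e 0" .
    then show ?case using pos \<rho>(1) by (intro exI[of _ "(of_nat d - of_nat (r - i)) / (of_nat d - of_nat i) * \<rho>"]) simp
  qed
  then obtain \<rho> where \<rho>: "\<And>i. i \<le> Suc r \<Longrightarrow> \<rho> i > 0 \<and> e i = (-1) ^ i * \<rho> i * e 0" by metis
  have "e 0 = 0"
  proof (cases "even (Suc r)")
    case True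
    \<comment> \<open>The constant drops out of the alternating binomial sum, whereas the
      alternating deviations all enter with the same sign.\<close>
    have "0 = (\<Sum>i\<le>Suc r. (-1) ^ i * of_nat (Suc r choose i) * u i (Suc r - i) (w - Suc r))"
      using apolar[OF True _ Suc.prems(1)] by simp
    also have "\<dots> = (\<Sum>i\<le>Suc r. of_nat (Suc r choose i) * \<rho> i * e 0 + (-1) ^ i * of_nat (Suc r choose i) * c)"
    proof (rule sum.cong)
      fix i assume i: "i \<in> {..Suc r}"
      have "u i (Suc r - i) (w - Suc r) = (-1) ^ i * \<rho> i * e 0 + c"
        using \<rho>[of i] i by (simp add: e_def)
      then show "(-1) ^ i * of_nat (Suc r choose i) * u i (Suc r - i) (w - Suc r)
        = of_nat (Suc r choose i) * \<rho> i * e 0 + (-1) ^ i * of_nat (Suc r choose i) * c"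
        by (simp add: distrib_left del: binomial_Suc_Suc)
    qed simp
    also have "\<dots> = (\<Sum>i\<le>Suc r. of_nat (Suc r choose i) * \<rho> i) * e 0"
      using choose_alternating_sum[of "Suc r", where 'a = rat]
      by (simp add: sum.distrib flip: sum_distrib_right del: binomial_Suc_Suc sum.atMost_Suc)
    finally have "(\<Sum>i\<le>Suc r. of_nat (Suc r choose i) * \<rho> i) * e 0 = 0" by simp
    moreover have "(\<Sum>i\<le>Suc r. of_nat (Suc r choose i) * \<rho> i) > 0"
      using \<rho> by (intro sum_pos) (auto simp del: binomial_Suc_Suc)
    ultimately show ?thesis by simp
  next
    case False
    have "e (Suc r) = e 0" using sym12[of "Suc r" 0] by (simp add: e_def)
    moreover have "e (Suc r) = - \<rho> (Suc r) * e 0" using \<rho>[of "Suc r"] False by simp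
    ultimately have "(1 + \<rho> (Suc r)) * e 0 = 0" by (simp add: algebra_simps)
    then show ?thesis using \<rho>[of "Suc r"] by auto
  qed
  then have "e i = 0" using \<rho>[of i] Suc.prems by simp
  then show ?case by (simp add: e_def c_def)
qed simp

text \<open>The binomial weights turn the raising operator into d/dx + d/dy + d/dz on the polynomial
  with these coefficients.\<close>

definition P :: "nat \<Rightarrow> nat \<Rightarrow> nat \<Rightarrow> rat" where
  "P i j k = of_nat (d choose i) * of_nat (d choose j) * of_nat (d choose k) * u i j k"

lemma P_invariant:
  assumes "Suc (i + j + k) = w"
  shows "of_nat (Suc i) * P (Suc i) j k + of_nat (Suc j) * P i (Suc j) k + of_nat (Suc k) * P i j (Suc k) = 0"
proof -
  define c where "c = of_nat (d choose i) * of_nat (d choose j) * (of_nat (d choose k) :: rat)"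
  have "of_nat (Suc i) * P (Suc i) j k = c * ((of_nat d - of_nat i) * u (Suc i) j k)"
    and "of_nat (Suc j) * P i (Suc j) k = c * ((of_nat d - of_nat j) * u i (Suc j) k)"
    and "of_nat (Suc k) * P i j (Suc k) = c * ((of_nat d - of_nat k) * u i j (Suc k))"
    unfolding P_def c_def binomial_Suc_quotient by (simp_all add: mult_ac del: of_nat_Suc)
  then have "of_nat (Suc i) * P (Suc i) j k + of_nat (Suc j) * P i (Suc j) k + of_nat (Suc k) * P i j (Suc k)
    = c * ((of_nat d - of_nat i) * u (Suc i) j k
        + (of_nat d - of_nat j) * u i (Suc j) k + (of_nat d - of_nat k) * u i j (Suc k))"
    by (simp only: distrib_left)
  then show ?thesis unfolding inv[OF assms] by simp
qed

lemma P_moments: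
  "i \<le> w \<Longrightarrow> P i 0 (w - i) = (-1) ^ (w - i) * (\<Sum>a\<le>w. of_nat (a choose i) * P a (w - a) 0)"
  by (rule translation_invariant_moments) (rule P_invariant)

lemma P_boundary:
  assumes "a < n" "a \<le> w"
  shows "P a (w - a) 0 = (-1) ^ a * slice_term d w a * u 0 0 w"
proof -
  have "u a (w - a) 0 = u a (a - a) (w - a)" by (subst sym23) simp
  also have "\<dots> = (-1) ^ a * slice_coeff d w a * u 0 0 w"
    using assms by (intro slice_value) simp_all
  finally show ?thesis by (simp add: P_def slice_term_def)
qed

lemma P_boundary_sym: "a \<le> w \<Longrightarrow> P a (w - a) 0 = P (w - a) (w - (w - a)) 0"
  using sym12[of a "w - a" 0] by (simp add: P_def)

lemma u_corner_zero: "u 0 0 w = 0"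
proof (cases "w \<le> d")
  case False
  have "u 0 0 w = u w 0 0" by (metis sym12 sym23)
  then show ?thesis using False out by simp
next
  case wd: True
  show ?thesis
  proof (rule ccontr)
    assume \<kappa>: "u 0 0 w \<noteq> 0"
    have large_w: "2 * n \<le> w + 2"
    proof (rule ccontr)
      assume small: "\<not> 2 * n \<le> w + 2"
      \<comment> \<open>A splitting of \<open>w\<close> into unequal parts that are both below
        \<open>n\<close>; it exists because w <= 2n - 3. Symmetry then equates two slice
        coefficients of different size.\<close>
      define k l where "k = min (n - 1) w" and "l = w - k"
      have kl: "k < n" "l < k" "k \<le> w" "l \<le> w" "w - l = k" "w - k = l"
        using small w_pos n_le wd d_less unfolding k_def l_def by (auto simp: min_def split: if_splits)
      have "u 0 k l = (-1) ^ k * slice_coeff d w k * u 0 0 w"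
        using slice_value[of k 0] kl by simp
      moreover have "u 0 l k = (-1) ^ l * slice_coeff d w l * u 0 0 w"
        using slice_value[of l 0] kl by simp
      ultimately have "(-1) ^ k * slice_coeff d w k = (-1) ^ l * slice_coeff d w l"
        using \<kappa> sym23[of 0 k l] by simp
      then have "\<bar>slice_coeff d w k\<bar> = \<bar>slice_coeff d w l\<bar>"
        by (metis abs_mult abs_neg_one power_abs power_one mult_1)
      then show False
        using slice_coeff_pos[OF wd, of k] slice_coeff_pos[OF wd, of l] slice_coeff_less[OF wd kl(3,2)] kl by simp
    qed
    define y where "y = slice_term d w"
    define m where "m = n - 1"
    \<comment> \<open>Now 2n - 2 <= w <= d <= 2n - 1, so the second alternative of
      \<open>large\<close> is impossible and n >= 6. The parity of \<open>n\<close> makes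
      \<open>m\<close> odd.\<close>
    have n: "n = Suc m" and m5: "5 \<le> m" and odd_m: "odd m"
      using large large_w wd even_n by (auto simp: m_def)
    have y_nonneg: "0 \<le> y a" if "a \<le> w" for a using slice_term_nonneg[OF wd that] by (simp add: y_def)
    have y_dec: "y (Suc a) \<le> y a" if "m \<le> a" "a < w" for a
      unfolding y_def using that d_less n by (intro slice_term_decreasing[OF wd]) auto
    have P00: "y 0 * u 0 0 w = (-1) ^ w * (\<Sum>a\<le>w. P a (w - a) 0)"
      using P_moments[of 0] by (simp add: P_def y_def slice_term_def)
    have low: "P a (w - a) 0 = (-1) ^ a * y a * u 0 0 w" if "a \<le> m" for a
      using P_boundary[of a] that large_w n m5 by (simp add: y_def)
    define Z where "Z = (\<Sum>a\<le>m. (-1) ^ a * y a)"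
    have split: "(\<Sum>a\<le>w. f a) = (\<Sum>a\<le>m. f a) + (\<Sum>i<w - m. f (n + i))" for f :: "nat \<Rightarrow> rat"
    proof -
      have "{..w} = {..m} \<union> {n..w}" "{..m} \<inter> {n..w} = {}" using large_w n m5 by auto
      then have "(\<Sum>a\<le>w. f a) = (\<Sum>a\<le>m. f a) + (\<Sum>a\<in>{n..w}. f a)"
        by (simp add: sum.union_disjoint)
      moreover have "(\<Sum>a\<in>{n..w}. f a) = (\<Sum>i<w - m. f (n + i))"
        using large_w n m5 by (intro sum.reindex_bij_witness[of _ "\<lambda>i. n + i" "\<lambda>a. a - n"]) auto
      ultimately show ?thesis by simp
    qed
    \<comment> \<open>Continuing the slice formula beyond \<open>m\<close> gives the alternating sum
      \<open>Z + tail\<close>, whose value is known. The actual row shares \<open>Z\<close> with it,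
      but its upper part is the mirror image of the lower one; the two are now compared.\<close>
    define tail where "tail = (\<Sum>i<w - m. (-1) ^ i * y (n + i))"
    have Ztail: "Z + tail = y w"
    proof -
      have "y w = (\<Sum>a\<le>w. (-1) ^ a * y a)" using slice_term_alternating_sum[OF wd] by (simp add: y_def)
      also have "\<dots> = Z + (\<Sum>i<w - m. (-1) ^ (n + i) * y (n + i))" unfolding split Z_def ..
      also have "(\<Sum>i<w - m. (-1) ^ (n + i) * y (n + i)) = tail"
        unfolding tail_def using even_n by (simp add: power_add)
      finally show ?thesis by simp
    qed
    have high: "(\<Sum>i<w - m. P (n + i) (w - (n + i)) 0) = (\<Sum>b<w - m. (-1) ^ b * y b * u 0 0 w)"
    proof (rule sum.reindex_bij_witness[of _ "\<lambda>b. w - n - b" "\<lambda>i. w - n - i"])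
      fix i assume i: "i \<in> {..<w - m}"
      have b: "w - n - i \<le> m" "w - (n + i) = w - n - i" "n + i \<le> w" "w - (w - n - i) = n + i"
        using i n d_less wd by auto
      show "(-1) ^ (w - n - i) * y (w - n - i) * u 0 0 w = P (n + i) (w - (n + i)) 0"
        using low[OF b(1)] P_boundary_sym[OF b(3)] by (simp only: b(2))
    qed (use n large_w m5 in auto)
    have sumP: "(\<Sum>a\<le>w. P a (w - a) 0) = (Z + (\<Sum>b<w - m. (-1) ^ b * y b)) * u 0 0 w"
      unfolding split high Z_def by (simp add: low sum_distrib_right distrib_right)
    have "w = 2 * m \<or> w = Suc (2 * m)" using large_w wd d_less n by auto
    then show False
    proof
      assume w: "w = 2 * m"
      have dd: "d = 2 * m \<or> d = Suc (2 * m)" using w wd d_less n by auto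
      have "{..m} = insert m {..<m}" by auto
      then have "(\<Sum>b<m. (-1) ^ b * y b) = Z + y m" unfolding Z_def using odd_m by simp
      moreover have "w - m = m" "(-1) ^ w = (1 :: rat)" using w by simp_all
      ultimately have "y 0 * u 0 0 w = (2 * Z + y m) * u 0 0 w" using P00 unfolding sumP by simp
      then have 1: "y 0 = 2 * Z + y m" using \<kappa> by simp
      \<comment> \<open>With \<open>tail <= y n\<close> the identity
        \<open>y 0 = 2 * Z + y m\<close> yields y 0 >= y m - 2 y n + 2 y w >= y m / 3 + 2 y w >= y 0
        + 2 y w, a contradiction.\<close>
      have "tail \<le> y n"
        using alternating_sum_bounds[of "w - m" "\<lambda>i. y (n + i)"] y_nonneg y_dec n w m5
        unfolding tail_def by auto
      then have "y 0 \<ge> y m - 2 * y n + 2 * y w" using 1 Ztail by linarith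
      moreover have "3 * y 0 \<le> y m" using slice_term_peak_even[OF m5 dd] w by (simp add: y_def)
      moreover have "3 * y n \<le> y m"
        unfolding y_def n using dd w m5 by (intro slice_term_third) auto
      moreover have "y w > 0" using slice_coeff_pos[OF wd, of w] wd by (simp add: y_def slice_term_def)
      ultimately show False using y_nonneg[of 0] by simp
    next
      assume w: "w = Suc (2 * m)"
      have dd: "d = w" using w wd d_less n by auto
      have "{..<w - m} = {..m}" using w by auto
      then have "y 0 * u 0 0 w = - (2 * Z) * u 0 0 w" using P00 sumP w by (simp add: Z_def)
      then have 1: "y 0 = - (2 * Z)" using \<kappa> by (metis mult_right_cancel)
      \<comment> \<open>This time the tail is bounded from below: 1 = y 0 = -2Z forces it to equal y
        w + 1/2, which its first two terms already exceed.\<close>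
      obtain v where v: "w - m = Suc v" "0 < v" using w m5 by (cases "w - m") auto
      have "(\<Sum>i<v. (-1) ^ i * y (n + Suc i)) \<le> y (Suc n)"
        using alternating_sum_bounds[of v "\<lambda>i. y (n + Suc i)"] y_nonneg y_dec n w m5 v by auto
      moreover have "tail = y n - (\<Sum>i<v. (-1) ^ i * y (n + Suc i))"
        unfolding tail_def v(1) sum.lessThan_Suc_shift by (simp add: sum_negf)
      ultimately have "y n - y (Suc n) \<le> tail" by simp
      moreover have "1 + 2 * y w < 2 * (y n - y (Suc n))"
        using slice_term_peak_odd[OF m5] w dd n by (simp add: y_def)
      moreover have "y 0 = 1" using dd by (simp add: y_def slice_term_def)
      moreover have "2 * (Z + tail) = 2 * y w" by (simp only: Ztail)
      then have "2 * tail = 2 * y w + y 0" using 1 by (simp add: distrib_left)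
      ultimately show False by simp
    qed
  qed
qed

lemma boundary_zero: "P a b 0 = 0" if ab: "a + b = w"
proof -
  define p where "p a = (if a \<le> w then P a (w - a) 0 else 0)" for a
  have low: "p a = 0" if "a < n" for a using P_boundary[of a] that u_corner_zero by (simp add: p_def)
  have high: "p a = 0" if "d < a" for a using that out by (simp add: p_def P_def)
  \<comment> \<open>The window is padded beyond \<open>d\<close> to length exactly \<open>n\<close>;
    the added entries are zero.\<close>
  have "p a = 0" if "a \<in> {n..<n + n}" for a
  proof (rule binomial_moments_zero[OF _ that])
    fix i assume i: "i < n"
    show "(\<Sum>a\<in>{n..<n + n}. of_nat (a choose i) * p a) = 0"
    proof (cases "i \<le> w")
      case True
      have "u i 0 (w - i) = 0"
        using slice_value[of i i] i True u_corner_zero by simp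
      then have "(\<Sum>a\<le>w. of_nat (a choose i) * P a (w - a) 0) = 0"
        using P_moments[OF True] by (simp add: P_def)
      also have "(\<Sum>a\<le>w. of_nat (a choose i) * P a (w - a) 0) = (\<Sum>a\<le>w. of_nat (a choose i) * p a)"
        by (simp add: p_def)
      also have "\<dots> = (\<Sum>a\<in>{..w} \<union> {n..<n + n}. of_nat (a choose i) * p a)"
        by (rule sum.mono_neutral_left) (auto simp: p_def)
      also have "\<dots> = (\<Sum>a\<in>{n..<n + n}. of_nat (a choose i) * p a)"
        using low high d_less by (intro sum.mono_neutral_right) (auto simp: not_less)
      finally show ?thesis .
    qed (auto simp: p_def binomial_eq_0 intro!: sum.neutral)
  qed
  then have "p a = 0" using low[of a] high[of a] d_less by (cases "a < n"; cases "d < a") auto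
  then show ?thesis using ab by (auto simp: p_def split: if_splits)
qed

text \<open>Invariance expresses an entry with third index c + 1 through entries with third index c,
  so everything reduces to the row c = 0.\<close>

theorem vanishes: "u i j k = 0" if "i + j + k = w"
proof (cases "i \<le> d \<and> j \<le> d \<and> k \<le> d")
  case True
  have "P a b c = 0" if "a + b + c = w" for a b c
    using that
  proof (induction c arbitrary: a b)
    case 0
    then show ?case using boundary_zero by simp
  next
    case (Suc c)
    then have "P (Suc a) b c = 0" "P a (Suc b) c = 0" by simp_all
    then show ?case using P_invariant[of a b c] Suc.prems by (simp del: of_nat_Suc)
  qed
  from this[OF that] show ?thesis using True by (simp add: P_def)
next
  case False
  then show ?thesis using out by (metis not_le sym12 sym23)
qed

end

subsection \<open>Transvectants of arrays\<close>

definition apolar_inner :: "(nat \<Rightarrow> nat \<Rightarrow> rat) \<Rightarrow> nat \<Rightarrow> nat \<Rightarrow> nat \<Rightarrow> rat" where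
  "apolar_inner u r j l = (\<Sum>i\<le>r. (-1) ^ i * of_nat (r choose i) * u (j + i) (l + r - i))"

text \<open>Coefficient number \<open>s\<close> of the r-th transvectant of the generic form with
  itself, after replacing a_i a_j by \<open>u i j\<close>; compare \<open>h_coeff\<close>.\<close>

definition transvect :: "nat \<Rightarrow> (nat \<Rightarrow> nat \<Rightarrow> rat) \<Rightarrow> nat \<Rightarrow> nat \<Rightarrow> rat" where
  "transvect d u r s = (\<Sum>j\<le>s. of_nat ((d - r) choose j) * of_nat ((d - r) choose (s - j)) * apolar_inner u r j (s - j))"

definition raise2 :: "nat \<Rightarrow> (nat \<Rightarrow> nat \<Rightarrow> rat) \<Rightarrow> nat \<Rightarrow> nat \<Rightarrow> rat" where
  "raise2 d u i j = (of_nat d - of_nat i) * u (Suc i) j + (of_nat d - of_nat j) * u i (Suc j)"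

text \<open>The contraction is with (y - x)^r, which is translation invariant: the terms in which
  raising acts on it cancel (\<open>A\<close>), and raising for a form of order d - r
  remains.\<close>

lemma apolar_inner_raise2:
  "apolar_inner (raise2 d u) r j l = (of_nat d - of_nat r - of_nat j) * apolar_inner u r (Suc j) l
     + (of_nat d - of_nat r - of_nat l) * apolar_inner u r j (Suc l)"
proof -
  have A: "(\<Sum>i\<le>r. (-1) ^ i * of_nat (r choose i) * ((of_nat r - of_nat i) * u (Suc (j + i)) (l + r - i)))
     + (\<Sum>i\<le>r. (-1) ^ i * of_nat (r choose i) * (of_nat i * u (j + i) (Suc (l + r - i)))) = 0"
  proof (cases r)
    case (Suc q)
    have "(\<Sum>i\<le>r. (-1) ^ i * of_nat (r choose i) * (of_nat i * u (j + i) (Suc (l + r - i))))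
      = (\<Sum>i\<le>q. (-1) ^ Suc i * (of_nat (Suc i) * of_nat (r choose Suc i)) * u (Suc (j + i)) (Suc (l + r - Suc i)))"
      unfolding Suc sum.atMost_Suc_shift by (simp add: mult_ac del: binomial_Suc_Suc of_nat_Suc)
    also have "\<dots> = - (\<Sum>i\<le>q. (-1) ^ i * of_nat (r choose i) * ((of_nat r - of_nat i) * u (Suc (j + i)) (l + r - i)))"
      unfolding binomial_Suc_rat sum_negf[symmetric]
      by (rule sum.cong) (simp_all add: Suc Suc_diff_le algebra_simps del: binomial_Suc_Suc of_nat_Suc)
    also have "(\<Sum>i\<le>q. (-1) ^ i * of_nat (r choose i) * ((of_nat r - of_nat i) * u (Suc (j + i)) (l + r - i)))
      = (\<Sum>i\<le>r. (-1) ^ i * of_nat (r choose i) * ((of_nat r - of_nat i) * u (Suc (j + i)) (l + r - i)))"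
      unfolding Suc by simp
    finally show ?thesis by simp
  qed simp
  have "apolar_inner (raise2 d u) r j l
    = (\<Sum>i\<le>r. ((of_nat d - of_nat r - of_nat j) * ((-1) ^ i * of_nat (r choose i) * u (Suc j + i) (l + r - i))
      + (of_nat d - of_nat r - of_nat l) * ((-1) ^ i * of_nat (r choose i) * u (j + i) (Suc l + r - i)))
      + ((-1) ^ i * of_nat (r choose i) * ((of_nat r - of_nat i) * u (Suc (j + i)) (l + r - i))
      + (-1) ^ i * of_nat (r choose i) * (of_nat i * u (j + i) (Suc (l + r - i)))))"
    unfolding apolar_inner_def
  proof (rule sum.cong)
    fix i assume "i \<in> {..r}"
    then have "of_nat (l + r - i) = (of_nat l + of_nat r - of_nat i :: rat)" "Suc l + r - i = Suc (l + r - i)"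
      by (simp_all add: of_nat_diff Suc_diff_le)
    then show "(-1) ^ i * of_nat (r choose i) * raise2 d u (j + i) (l + r - i)
      = ((of_nat d - of_nat r - of_nat j) * ((-1) ^ i * of_nat (r choose i) * u (Suc j + i) (l + r - i))
      + (of_nat d - of_nat r - of_nat l) * ((-1) ^ i * of_nat (r choose i) * u (j + i) (Suc l + r - i)))
      + ((-1) ^ i * of_nat (r choose i) * ((of_nat r - of_nat i) * u (Suc (j + i)) (l + r - i))
      + (-1) ^ i * of_nat (r choose i) * (of_nat i * u (j + i) (Suc (l + r - i))))"
      by (simp add: raise2_def algebra_simps)
  qed simp
  then show ?thesis
    unfolding sum.distrib A by (simp add: apolar_inner_def sum_distrib_left)
qed

text \<open>Equivariance: with the binomial weights of order d - r, raising becomes differentiation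
  of the transvectant.\<close>

lemma transvect_raise2:
  assumes "r \<le> d"
  shows "transvect d (raise2 d u) r s = of_nat (Suc s) * transvect d u r (Suc s)"
proof -
  define D where "D = d - r"
  have D: "of_nat D = (of_nat d - of_nat r :: rat)" using assms by (simp add: D_def of_nat_diff)
  have "transvect d (raise2 d u) r s
     = (\<Sum>j\<le>s. ((of_nat D - of_nat j) * of_nat (D choose j)) * of_nat (D choose (s - j)) * apolar_inner u r (Suc j) (s - j))
     + (\<Sum>j\<le>s. ((of_nat D - of_nat (s - j)) * of_nat (D choose (s - j))) * of_nat (D choose j) * apolar_inner u r j (Suc (s - j)))"
    unfolding transvect_def apolar_inner_raise2 D_def[symmetric] D[symmetric] sum.distrib[symmetric]
    by (rule sum.cong) (simp_all add: algebra_simps)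
  also have "(\<Sum>j\<le>s. ((of_nat D - of_nat j) * of_nat (D choose j)) * of_nat (D choose (s - j)) * apolar_inner u r (Suc j) (s - j))
     = (\<Sum>j\<le>Suc s. of_nat j * (of_nat (D choose j) * of_nat (D choose (Suc s - j)) * apolar_inner u r j (Suc s - j)))"
    unfolding sum.atMost_Suc_shift binomial_Suc_rat[symmetric] by (simp add: mult_ac del: binomial_Suc_Suc of_nat_Suc)
  also have "(\<Sum>j\<le>s. ((of_nat D - of_nat (s - j)) * of_nat (D choose (s - j))) * of_nat (D choose j) * apolar_inner u r j (Suc (s - j)))
     = (\<Sum>j\<le>Suc s. of_nat (Suc s - j) * (of_nat (D choose j) * of_nat (D choose (Suc s - j)) * apolar_inner u r j (Suc s - j)))"
    unfolding binomial_Suc_rat[symmetric] sum.atMost_Suc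
    by (simp del: of_nat_Suc of_nat_diff add: Suc_diff_le mult_ac)
  also have "(\<Sum>j\<le>Suc s. of_nat j * (of_nat (D choose j) * of_nat (D choose (Suc s - j)) * apolar_inner u r j (Suc s - j)))
     + \<dots> = of_nat (Suc s) * transvect d u r (Suc s)"
    unfolding transvect_def D_def[symmetric] sum_distrib_left sum.distrib[symmetric]
    by (rule sum.cong) (simp_all add: of_nat_diff flip: distrib_right of_nat_add del: of_nat_Suc)
  finally show ?thesis .
qed

lemma transvect_add: "transvect d (\<lambda>i j. f i j + g i j) r s = transvect d f r s + transvect d g r s"
  by (simp add: transvect_def apolar_inner_def distrib_left sum.distrib)

lemma transvect_scale: "transvect d (\<lambda>i j. c * f i j) r s = c * transvect d f r s"
  by (simp add: transvect_def apolar_inner_def sum_distrib_left mult_ac)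

text \<open>Entries with an index beyond \<open>d\<close> meet only vanishing binomials, so arrays
  may be cut off at \<open>d\<close>.\<close>

lemma transvect_cong:
  assumes "\<And>i j. i \<le> d \<Longrightarrow> j \<le> d \<Longrightarrow> i + j = r + s \<Longrightarrow> f i j = g i j" "r \<le> d"
  shows "transvect d f r s = transvect d g r s"
  unfolding transvect_def
proof (rule sum.cong)
  fix j assume j: "j \<in> {..s}"
  show "of_nat ((d - r) choose j) * of_nat ((d - r) choose (s - j)) * apolar_inner f r j (s - j)
    = of_nat ((d - r) choose j) * of_nat ((d - r) choose (s - j)) * apolar_inner g r j (s - j)"
  proof (cases "j \<le> d - r \<and> s - j \<le> d - r")
    case True
    then have "apolar_inner f r j (s - j) = apolar_inner g r j (s - j)"
      unfolding apolar_inner_def using assms j by (intro sum.cong refl arg_cong2[of _ _ _ _ "(*)"]) auto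
    then show ?thesis by simp
  qed (auto simp: binomial_eq_0)
qed simp

lemma transvect_const: "0 < r \<Longrightarrow> transvect d (\<lambda>i j. c) r s = 0"
  using choose_alternating_sum[of r, where 'a = rat]
  by (simp add: transvect_def apolar_inner_def flip: sum_distrib_right)

lemma transvect_0: "transvect d u r 0 = (\<Sum>i\<le>r. (-1) ^ i * of_nat (r choose i) * u i (r - i))"
  by (simp add: transvect_def apolar_inner_def)

definition raise3 :: "nat \<Rightarrow> (nat \<Rightarrow> nat \<Rightarrow> nat \<Rightarrow> rat) \<Rightarrow> nat \<Rightarrow> nat \<Rightarrow> nat \<Rightarrow> rat" where
  "raise3 d u i j k = (of_nat d - of_nat i) * u (Suc i) j k + (of_nat d - of_nat j) * u i (Suc j) k
     + (of_nat d - of_nat k) * u i j (Suc k)"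

text \<open>Hence, if the r-th transvectants of an array vanish for all \<open>s\<close> and
  \<open>k\<close>, so do those of the raised array.\<close>

lemma transvect_raise3:
  assumes "r \<le> d"
  shows "transvect d (\<lambda>i j. raise3 d u i j k) r s = of_nat (Suc s) * transvect d (\<lambda>i j. u i j k) r (Suc s)
    + (of_nat d - of_nat k) * transvect d (\<lambda>i j. u i j (Suc k)) r s"
proof -
  have "(\<lambda>i j. raise3 d u i j k) = (\<lambda>i j. raise2 d (\<lambda>i j. u i j k) i j + (of_nat d - of_nat k) * u i j (Suc k))"
    by (simp add: raise3_def raise2_def)
  moreover have "transvect d (\<lambda>i j. raise2 d (\<lambda>i j. u i j k) i j + (of_nat d - of_nat k) * u i j (Suc k)) r s
    = transvect d (raise2 d (\<lambda>i j. u i j k)) r s + (of_nat d - of_nat k) * transvect d (\<lambda>i j. u i j (Suc k)) r s"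
    unfolding transvect_add transvect_scale ..
  ultimately show ?thesis
    by (simp only: transvect_raise2[OF assms])
qed

text \<open>Induction on the weight \<open>w\<close>: raising lowers the weight by one, and its kernel on positive weights
  is trivial.\<close>
theorem apolar_trilinear_constant:
  fixes u :: "nat \<Rightarrow> nat \<Rightarrow> nat \<Rightarrow> rat"
  assumes "\<And>i j k. u i j k = u j i k" and "\<And>i j k. u i j k = u i k j" and "\<And>i j k. d < i \<Longrightarrow> u i j k = 0"
    and "\<And>r s k. even r \<Longrightarrow> 0 < r \<Longrightarrow> r < n \<Longrightarrow> transvect d (\<lambda>i j. u i j k) r s = 0"
    and n: "n \<le> d" "d < 2 * n" "even n" "6 \<le> n \<or> d + 3 \<le> 2 * n"
  shows "\<exists>c. \<forall>i j k. i + j + k = w \<longrightarrow> i \<le> d \<longrightarrow> j \<le> d \<longrightarrow> k \<le> d \<longrightarrow> u i j k = c"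
  using assms(1-4)
proof (induction w arbitrary: u)
  case 0
  then show ?case by auto
next
  case (Suc w)
  note sym12 = Suc.prems(1) and sym23 = Suc.prems(2) and out = Suc.prems(3) and apolar = Suc.prems(4)
  have sym13: "u i j k = u k j i" for i j k by (metis sym12 sym23)
  have "\<exists>c. \<forall>i j k. i + j + k = w \<longrightarrow> i \<le> d \<longrightarrow> j \<le> d \<longrightarrow> k \<le> d \<longrightarrow> raise3 d u i j k = c"
  proof (rule Suc.IH)
    fix i j k
    show "raise3 d u i j k = raise3 d u j i k"
      unfolding raise3_def using sym12 by (simp add: algebra_simps)
    show "raise3 d u i j k = raise3 d u i k j"
      unfolding raise3_def using sym23 by (simp add: algebra_simps)
    assume "d < i"
    then show "raise3 d u i j k = 0" unfolding raise3_def using out by simp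
  next
    fix r s k assume r: "even r" "0 < r" "r < n"
    then have "r \<le> d" using n by simp
    then show "transvect d (\<lambda>i j. raise3 d u i j k) r s = 0"
      using apolar[OF r] by (simp add: transvect_raise3)
  qed
  then obtain c where c: "\<And>i j k. i + j + k = w \<Longrightarrow> i \<le> d \<Longrightarrow> j \<le> d \<Longrightarrow> k \<le> d \<Longrightarrow> raise3 d u i j k = c"
    by blast
  show ?case
  proof (cases "Suc w \<le> 3 * d")
    case False
    then show ?thesis by (intro exI[of _ 0]) auto
  next
    case True
    then have "of_nat (Suc w) \<le> (of_nat (3 * d) :: rat)" by (simp only: of_nat_le_iff)
    then have pos: "0 < 3 * of_nat d - (of_nat w :: rat)" by simp
    \<comment> \<open>The array with all entries \<open>b\<close> is raised to (3d - w) b in weight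
      \<open>w\<close>, so subtracting it leaves an array killed by raising. The factor is positive
      as long as some triple of weight w + 1 has all indices at most \<open>d\<close>.\<close>
    define b where "b = c / (3 * of_nat d - of_nat w)"
    define v where "v i j k = u i j k - (if i \<le> d \<and> j \<le> d \<and> k \<le> d then b else 0)" for i j k
    interpret invariant_trilinear d n "Suc w" v
    proof
      fix i j k
      show "v i j k = v j i k" using sym12 by (simp add: v_def conj_ac)
      show "v i j k = v i k j" using sym23 by (simp add: v_def conj_ac)
      show "d < i \<Longrightarrow> v i j k = 0" using out by (simp add: v_def)
    next
      fix r k assume r: "even r" "0 < r" "r < n"
      have rd: "r \<le> d" using r n by simp
      have "transvect d (\<lambda>i j. v i j k) r 0
        = transvect d (\<lambda>i j. u i j k + (-1) * (if k \<le> d then b else 0)) r 0"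
        by (rule transvect_cong[OF _ rd]) (simp add: v_def)
      also have "\<dots> = 0"
        unfolding transvect_add transvect_scale using apolar[OF r] transvect_const[OF r(2)] by simp
      finally show "(\<Sum>i\<le>r. (-1) ^ i * of_nat (r choose i) * v i (r - i) k) = 0"
        by (simp add: transvect_0)
    next
      fix i j k assume w: "Suc (i + j + k) = Suc w"
      have zero: "v i j k = 0" if "d < i \<or> d < j \<or> d < k" for i j k
        using that out[of i j k] out[of j i k] out[of k j i] sym12[of i j k] sym13[of i j k] by (auto simp: v_def)
      show "(of_nat d - of_nat i) * v (Suc i) j k + (of_nat d - of_nat j) * v i (Suc j) k
        + (of_nat d - of_nat k) * v i j (Suc k) = 0"
      proof (cases "i \<le> d \<and> j \<le> d \<and> k \<le> d")
        case True
        \<comment> \<open>The cutoff in \<open>v\<close> does no harm: where an index passes from d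
          to d + 1, the factor d - i is zero.\<close>
        have *: "(of_nat d - of_nat i) * v (Suc i) j k = (of_nat d - of_nat i) * (u (Suc i) j k - b)"
            "(of_nat d - of_nat j) * v i (Suc j) k = (of_nat d - of_nat j) * (u i (Suc j) k - b)"
            "(of_nat d - of_nat k) * v i j (Suc k) = (of_nat d - of_nat k) * (u i j (Suc k) - b)"
          using True by (auto simp: v_def)
        have "of_nat w = (of_nat i + of_nat j + of_nat k :: rat)" using w by (simp flip: of_nat_add)
        then have "3 * of_nat d - of_nat i - of_nat j - of_nat k = (3 * of_nat d - of_nat w :: rat)" by simp
        then have "(3 * of_nat d - of_nat i - of_nat j - of_nat k) * b = c"
          using pos by (simp only: b_def) simp
        moreover have "raise3 d u i j k = c" using c w True by simp
        ultimately show ?thesis unfolding * raise3_def by (simp add: algebra_simps)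
      next
        case False
        then have "v (Suc i) j k = 0" "v i (Suc j) k = 0" "v i j (Suc k) = 0" by (auto intro!: zero)
        then show ?thesis by simp
      qed
    qed (use n in simp_all)
    have "u i j k = b" if "i + j + k = Suc w" "i \<le> d" "j \<le> d" "k \<le> d" for i j k
      using vanishes[OF that(1)] that by (simp add: v_def)
    then show ?thesis by blast
  qed
qed

corollary apolar_trilinear_next:
  fixes u :: "nat \<Rightarrow> nat \<Rightarrow> nat \<Rightarrow> rat"
  assumes "\<And>i j k. u i j k = u j i k" and "\<And>i j k. u i j k = u i k j" and "\<And>i j k. d < i \<Longrightarrow> u i j k = 0"
    and "\<And>r s k. even r \<Longrightarrow> 0 < r \<Longrightarrow> r < n \<Longrightarrow> transvect d (\<lambda>i j. u i j k) r s = 0"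
    and n: "n \<le> d" "d < 2 * n" "even n" "6 \<le> n \<or> d + 3 \<le> 2 * n" and "k \<le> d"
  shows "transvect d (\<lambda>i j. u i j k) n s = 0"
proof -
  obtain c where "\<And>i j l. i + j + l = n + s + k \<Longrightarrow> i \<le> d \<Longrightarrow> j \<le> d \<Longrightarrow> l \<le> d \<Longrightarrow> u i j l = c"
    using apolar_trilinear_constant[of u d n "n + s + k", OF assms(1-8)] by blast
  then have "transvect d (\<lambda>i j. u i j k) n s = transvect d (\<lambda>i j. c) n s"
    using n \<open>k \<le> d\<close> by (intro transvect_cong) auto
  then show ?thesis using n by (simp add: transvect_const)
qed

text \<open>The coefficients of (x - y)^n in the dual normalisation: dividing by the weights of the
  generic form makes raising act as d/dx + d/dy, which kills (x - y)^n.\<close>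

definition apolar_form :: "nat \<Rightarrow> nat \<Rightarrow> nat \<Rightarrow> nat \<Rightarrow> rat" where
  "apolar_form d n i j = (if i + j = n then (-1) ^ i * of_nat (n choose i) / (of_nat (d choose i) * of_nat (d choose j)) else 0)"

text \<open>By weight only s = n - r > 0 is in question. There the transvectant is a multiple of one
  of the raised array, which is zero.\<close>

lemma transvect_apolar_form_zero:
  assumes "n \<le> d" "r < n"
  shows "transvect d (apolar_form d n) r s = 0"
proof (cases "r + s = n")
  case False
  have "transvect d (apolar_form d n) r s = transvect d (\<lambda>i j. 0 * 0) r s"
    using assms False by (intro transvect_cong) (auto simp: apolar_form_def)
  then show ?thesis unfolding transvect_scale by simp
next
  case True
  then obtain s' where s: "s = Suc s'" using assms by (cases s) auto
  have "transvect d (raise2 d (apolar_form d n)) r s' = transvect d (\<lambda>i j. 0 * 0) r s'"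
  proof (rule transvect_cong)
    fix i j assume ij: "i + j = r + s'"
    have n: "n = Suc (i + j)" "i < d" "j < d" using True s ij assms by auto
    have "of_nat i < (of_nat d :: rat)" "of_nat j < (of_nat d :: rat)" using n by simp_all
    have *: "of_nat (n choose Suc i) * of_nat (Suc i) = (of_nat (Suc j) * of_nat (n choose i) :: rat)"
      using binomial_Suc_rat[of i n] n by (simp add: mult.commute del: of_nat_Suc)
    have pos: "(of_nat (d choose i) :: rat) \<noteq> 0" "(of_nat (d choose j) :: rat) \<noteq> 0"
      "of_nat d - of_nat i \<noteq> (0::rat)" "of_nat d - of_nat j \<noteq> (0::rat)"
      using n by auto
    have "(of_nat d - of_nat i) * apolar_form d n (Suc i) j
      = - ((-1) ^ i * (of_nat (n choose Suc i) * of_nat (Suc i)) / (of_nat (d choose i) * of_nat (d choose j)))"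
      using pos n(1) unfolding apolar_form_def binomial_Suc_quotient[of d] by (simp add: field_simps del: of_nat_Suc binomial_Suc_Suc)
    moreover have "(of_nat d - of_nat j) * apolar_form d n i (Suc j)
      = (-1) ^ i * (of_nat (Suc j) * of_nat (n choose i)) / (of_nat (d choose i) * of_nat (d choose j))"
      using pos n(1) unfolding apolar_form_def binomial_Suc_quotient[of d] by (simp add: field_simps del: of_nat_Suc binomial_Suc_Suc)
    ultimately show "raise2 d (apolar_form d n) i j = 0 * 0"
      unfolding raise2_def * by simp
  qed (use assms in simp)
  then have "of_nat (Suc s') * transvect d (apolar_form d n) r s = 0"
    unfolding transvect_scale s using assms by (subst transvect_raise2[symmetric]) simp_all
  then show ?thesis by (simp del: of_nat_Suc)
qed

text \<open>The signs of the form and of the transvectant cancel, so all summands are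
  positive.\<close>

lemma transvect_apolar_form_pos:
  assumes "n \<le> d"
  shows "0 < transvect d (apolar_form d n) n 0"
proof -
  have "transvect d (apolar_form d n) n 0
    = (\<Sum>i\<le>n. of_nat (n choose i) * of_nat (n choose i) / (of_nat (d choose i) * of_nat (d choose (n - i))))"
    unfolding transvect_0 apolar_form_def by (rule sum.cong) (simp_all add: power_mult_distrib[symmetric] mult_ac flip: power_add)
  also have "\<dots> > 0" using assms by (intro sum_pos) auto
  finally show ?thesis .
qed

subsection \<open>Coefficients of the covariants\<close>

lemma const_q_0 [simp]: "const_q 0 = 0" and const_q_1 [simp]: "const_q 1 = 1"
  and const_q_add: "const_q (a + b) = const_q a + const_q b"
  and const_q_mult: "const_q (a * b) = const_q a * const_q b"
  and const_q_uminus: "const_q (- a) = - const_q a"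
  by (simp_all add: const_q_def single_add mult_single single_uminus)

lemma const_q_of_nat: "const_q (of_nat n) = of_nat n"
  by (induction n) (simp_all add: const_q_add)

lemma const_q_sign: "const_q ((-1) ^ i) = (-1) ^ i"
  by (induction i) (simp_all add: const_q_mult const_q_uminus)

section \<open>Binary forms given by their coefficients\<close>

definition bin_form :: "nat \<Rightarrow> (nat \<Rightarrow> qmpoly) \<Rightarrow> biv" where
  "bin_form N c = (\<Sum>s\<le>N. monom (monom (c s) s) (N - s))"

lemma coeff_bin_form: "coeff (coeff (bin_form N c) i) j = (if i + j = N then c j else 0)"
proof -
  have "coeff (coeff (bin_form N c) i) j = (\<Sum>s\<le>N. if s = j \<and> i + j = N then c j else 0)"
    unfolding bin_form_def coeff_sum by (intro sum.cong) (auto split: if_splits)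
  also have "\<dots> = (if i + j = N then c j else 0)" by auto
  finally show ?thesis .
qed

lemma bin_form_eqI:
  assumes "\<And>i j. coeff (coeff A i) j = (if i + j = N then c j else 0)"
  shows "A = bin_form N c"
  by (intro poly_eqI) (simp add: assms coeff_bin_form)

lemma bin_form_sum: "(\<Sum>i\<in>I. bin_form N (f i)) = bin_form N (\<lambda>s. \<Sum>i\<in>I. f i s)"
  by (rule bin_form_eqI) (simp add: coeff_sum coeff_bin_form)

lemma bin_form_smult: "smult [:c:] (bin_form N f) = bin_form N (\<lambda>s. c * f s)"
  by (rule bin_form_eqI) (simp add: coeff_bin_form)

lemma bin_form_cong: "(\<And>s. s \<le> N \<Longrightarrow> f s = g s) \<Longrightarrow> bin_form N f = bin_form N g"
  unfolding bin_form_def by (rule sum.cong) auto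

lemma bin_form_mult:
  assumes "\<And>i. D < i \<Longrightarrow> f i = 0" "\<And>i. E < i \<Longrightarrow> g i = 0"
  shows "bin_form D f * bin_form E g = bin_form (D + E) (\<lambda>s. \<Sum>j\<le>s. f j * g (s - j))"
proof -
  define T where "T i j = monom (monom (f i * g j) (i + j)) (D + E - (i + j))" for i j
  have "bin_form D f * bin_form E g = (\<Sum>i\<le>D. \<Sum>j\<le>E. T i j)"
    unfolding bin_form_def sum_product T_def by (intro sum.cong) (auto simp: mult_monom)
  also have "\<dots> = (\<Sum>(i, j)\<in>{..D} \<times> {..E}. T i j)" by (simp add: sum.cartesian_product)
  also have "\<dots> = (\<Sum>(i, j)\<in>{(i, j). i + j < Suc (D + E)}. T i j)"
  proof (rule sum.mono_neutral_left)
    show "finite {(i, j). i + j < Suc (D + E)}"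
      by (rule finite_subset[of _ "{..D + E} \<times> {..D + E}"]) auto
    show "\<forall>x\<in>{(i, j). i + j < Suc (D + E)} - {..D} \<times> {..E}. (case x of (i, j) \<Rightarrow> T i j) = 0"
      using assms by (auto simp: T_def) (metis not_le mult_zero_left mult_zero_right)+
  qed auto
  also have "\<dots> = (\<Sum>s\<le>D + E. \<Sum>i\<le>s. T i (s - i))"
    unfolding sum.triangle_reindex lessThan_Suc_atMost ..
  also have "\<dots> = bin_form (D + E) (\<lambda>s. \<Sum>j\<le>s. f j * g (s - j))"
    unfolding bin_form_def monom_sum T_def by (intro sum.cong) auto
  finally show ?thesis .
qed


section \<open>Partial derivatives of the generic form\<close>

lemma pochhammer_Suc_rat: "of_nat (pochhammer (Suc n) m) = (fact (n + m) / fact n :: rat)"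
proof -
  have "fact (n + m) = fact n * pochhammer (Suc n) m"
    unfolding pochhammer_fact using pochhammer_product'[of "1::nat" n m] by simp
  then have "(of_nat (fact (n + m)) :: rat) = of_nat (fact n) * of_nat (pochhammer (Suc n) m)"
    by (simp only: of_nat_mult)
  then show ?thesis by simp
qed

lemma coeff_partials:
  "coeff (coeff ((dx1 ^^ a) ((dx2 ^^ b) A)) p) s
    = const_q (fact (p + a) / fact p * (fact (s + b) / fact s)) * coeff (coeff A (p + a)) (s + b)"
proof -
  have "coeff ((dx2 ^^ b) A) i = (pderiv ^^ b) (coeff A i)" for i
    by (induction b) (simp_all add: dx2_def coeff_map_poly)
  moreover have dx1: "dx1 = pderiv" by (rule ext) (simp add: dx1_def)
  ultimately have "coeff (coeff ((dx1 ^^ a) ((dx2 ^^ b) A)) p) s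
    = coeff (pochhammer (of_nat (Suc p)) a * (pderiv ^^ b) (coeff A (p + a))) s"
    by (simp only: dx1 coeff_higher_pderiv)
  also have "\<dots> = of_nat (pochhammer (Suc p) a) * (of_nat (pochhammer (Suc s) b) * coeff (coeff A (p + a)) (s + b))"
  proof -
    have "pochhammer (of_nat (Suc p)) a = [:of_nat (pochhammer (Suc p) a) :: qmpoly:]"
      by (subst pochhammer_of_nat) (rule of_nat_poly)
    then show ?thesis by (simp add: coeff_higher_pderiv pochhammer_of_nat del: of_nat_Suc)
  qed
  also have "\<dots> = const_q (fact (p + a) / fact p * (fact (s + b) / fact s)) * coeff (coeff A (p + a)) (s + b)"
    by (simp only: const_q_of_nat[symmetric] pochhammer_Suc_rat const_q_mult mult.assoc)
  finally show ?thesis .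
qed

lemma generic_form_bin_form: "generic_form d = bin_form d (\<lambda>i. const_q (of_nat (d choose i)) * var_a i)"
  by (simp add: generic_form_def bin_form_def const_q_of_nat atLeast0AtMost)

text \<open>Thanks to its binomial weights, differentiating the generic form only lowers its order
  and shifts the indices of its variables, up to a scalar that depends on \<open>r\<close>
  alone.\<close>

lemma partials_generic_form:
  assumes "a + b = r" "r \<le> d"
  shows "(dx1 ^^ a) ((dx2 ^^ b) (generic_form d)) = bin_form (d - r)
    (\<lambda>s. const_q (fact d / fact (d - r) * of_nat ((d - r) choose s)) * var_a (s + b))"
proof (rule bin_form_eqI)
  fix p s
  show "coeff (coeff ((dx1 ^^ a) ((dx2 ^^ b) (generic_form d))) p) s
    = (if p + s = d - r then const_q (fact d / fact (d - r) * of_nat ((d - r) choose s)) * var_a (s + b) else 0)"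
  proof (cases "p + s = d - r")
    case True
    have d: "p + a + (s + b) = d" "d - (s + b) = p + a" "d - r - s = p" "s \<le> d - r" "s + b \<le> d"
      using True assms by auto
    have "fact (p + a) / fact p * (fact (s + b) / fact s) * of_nat (d choose (s + b))
      = (fact d / fact (d - r) * of_nat ((d - r) choose s) :: rat)"
      using d by (simp add: binomial_fact)
    then show ?thesis
      using True d(1) unfolding coeff_partials generic_form_bin_form coeff_bin_form
      by (simp only: refl if_True mult.assoc[symmetric] const_q_mult[symmetric])
  next
    case False
    then have "p + a + (s + b) \<noteq> d" using assms by auto
    then show ?thesis using False by (simp add: coeff_partials generic_form_bin_form coeff_bin_form)
  qed
qed

text \<open>The same double sum as \<open>transvect\<close>, with a_i a_j as the array, so that a
  linear functional turns one into the other.\<close>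

definition h_coeff :: "nat \<Rightarrow> nat \<Rightarrow> nat \<Rightarrow> qmpoly" where
  "h_coeff d r s = (\<Sum>j\<le>s. const_q (of_nat ((d - r) choose j) * of_nat ((d - r) choose (s - j))) *
     (\<Sum>i\<le>r. const_q ((-1) ^ i * of_nat (r choose i)) * (var_a (j + i) * var_a (s - j + r - i))))"

lemma covariant_H_bin_form:
  assumes "r \<le> d"
  shows "covariant_H d r = bin_form (2 * (d - r)) (h_coeff d r)"
proof -
  define K where "K = (fact d / fact (d - r) :: rat)"
  define D where "D = d - r"
  have sgn: "(-1) ^ i * of_nat k * A * B = smult [:const_q ((-1) ^ i * of_nat k):] (A * B)" for i k and A B :: biv
  proof -
    have "(-1) ^ i * of_nat k = (of_int ((-1) ^ i * int k) :: biv)" by simp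
    also have "\<dots> = [:[:of_int ((-1) ^ i * int k):]:]" by (simp only: of_int_poly)
    also have "of_int ((-1) ^ i * int k) = const_q ((-1) ^ i * of_nat k)"
      by (simp add: const_q_mult const_q_sign const_q_of_nat)
    finally show ?thesis by (simp add: mult.assoc)
  qed
  have "covariant_H d r = smult [:const_q (fact D * fact D / (fact d * fact d)):]
    (\<Sum>i\<le>r. smult [:const_q ((-1) ^ i * of_nat (r choose i)):]
       (bin_form D (\<lambda>s. const_q (K * of_nat (D choose s)) * var_a (s + i))
       * bin_form D (\<lambda>s. const_q (K * of_nat (D choose s)) * var_a (s + (r - i)))))"
    unfolding covariant_H_def transvectant_def atLeast0AtMost D_def[symmetric]
    using assms by (intro arg_cong2[of _ _ _ _ smult] sum.cong refl)
      (simp add: partials_generic_form[of _ _ r] sgn K_def D_def)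
  also have "\<dots> = bin_form (D + D) (\<lambda>s. const_q (fact D * fact D / (fact d * fact d)) *
    (\<Sum>i\<le>r. const_q ((-1) ^ i * of_nat (r choose i)) *
      (\<Sum>j\<le>s. const_q (K * of_nat (D choose j)) * var_a (j + i) *
         (const_q (K * of_nat (D choose (s - j))) * var_a (s - j + (r - i))))))"
    by (subst bin_form_mult) (simp_all add: bin_form_smult bin_form_sum binomial_eq_0)
  also have "\<dots> = bin_form (D + D) (h_coeff d r)"
  proof (rule bin_form_cong)
    fix s
    \<comment> \<open>The factorials produced by the derivatives cancel the normalisation of the
      transvectant exactly.\<close>
    have K: "fact D * fact D / (fact d * fact d) * (K * K) = 1" by (simp add: K_def D_def)
    have scal: "const_q (fact D * fact D / (fact d * fact d)) * (const_q e *
        (const_q (K * x) * A * (const_q (K * y) * B))) = const_q (x * y) * (const_q e * (A * B))" for e x y A B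
    proof -
      have "const_q (fact D * fact D / (fact d * fact d)) * (const_q e *
        (const_q (K * x) * A * (const_q (K * y) * B)))
        = const_q (fact D * fact D / (fact d * fact d) * (K * K)) * (const_q (x * y) * (const_q e * (A * B)))"
        by (simp only: const_q_mult mult_ac)
      then show ?thesis unfolding K by simp
    qed
    show "const_q (fact D * fact D / (fact d * fact d)) *
    (\<Sum>i\<le>r. const_q ((-1) ^ i * of_nat (r choose i)) *
      (\<Sum>j\<le>s. const_q (K * of_nat (D choose j)) * var_a (j + i) *
         (const_q (K * of_nat (D choose (s - j))) * var_a (s - j + (r - i))))) = h_coeff d r s"
      unfolding h_coeff_def D_def[symmetric] sum_distrib_left scal
      by (subst sum.swap) (intro sum.cong, auto)
  qed
  finally show ?thesis by (simp add: D_def mult_2)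
qed

lemma form_coeffs_covariant_H:
  assumes "r \<le> d"
  shows "form_coeffs (covariant_H d r) \<subseteq> insert 0 (range (h_coeff d r))"
    and "s \<le> 2 * (d - r) \<Longrightarrow> h_coeff d r s \<in> form_coeffs (covariant_H d r)"
proof -
  show "form_coeffs (covariant_H d r) \<subseteq> insert 0 (range (h_coeff d r))"
    by (auto simp: form_coeffs_def covariant_H_bin_form[OF assms] coeff_bin_form)
  assume "s \<le> 2 * (d - r)"
  then have "h_coeff d r s = coeff (coeff (covariant_H d r) (2 * (d - r) - s)) s"
    by (simp add: covariant_H_bin_form[OF assms] coeff_bin_form)
  then show "h_coeff d r s \<in> form_coeffs (covariant_H d r)" unfolding form_coeffs_def by blast
qed

text \<open>The passage from ideals to arrays: \<open>x\<close> is a variable in degree three and 1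
  in degree two.\<close>

lemma linear_h_coeff:
  assumes add: "\<And>x y. \<phi> (x + y) = \<phi> x + \<phi> y" and scale: "\<And>c x. \<phi> (const_q c * x) = (c :: rat) * \<phi> x"
  shows "\<phi> (h_coeff d r s * x) = transvect d (\<lambda>i j. \<phi> (var_a i * var_a j * x)) r s"
proof -
  have z: "\<phi> 0 = 0" using scale[of 0 0] by simp
  have sum: "\<phi> (\<Sum>i\<in>I. f i) = (\<Sum>i\<in>I. \<phi> (f i))" for I :: "nat set" and f
    by (induction I rule: infinite_finite_induct) (simp_all add: z add)
  show ?thesis
    unfolding h_coeff_def sum_distrib_right transvect_def apolar_inner_def
    by (simp add: sum scale mult.assoc sum_distrib_right)
qed

subsection \<open>The ideals in degrees two and three\<close>

lemma mon_degree_superset: "finite A \<Longrightarrow> Poly_Mapping.keys m \<subseteq> A \<Longrightarrow> mon_degree m = (\<Sum>i\<in>A. Poly_Mapping.lookup m i)"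
  unfolding mon_degree_def by (rule sum.mono_neutral_left) (auto simp: in_keys_iff)

lemma mon_degree_add: "mon_degree (m + m') = mon_degree m + mon_degree m'"
proof -
  let ?A = "Poly_Mapping.keys m \<union> Poly_Mapping.keys m'"
  have "mon_degree (m + m') = (\<Sum>i\<in>?A. Poly_Mapping.lookup (m + m') i)"
    by (rule mon_degree_superset) (simp_all add: Poly_Mapping.keys_add)
  then show ?thesis
    by (simp add: lookup_add sum.distrib mon_degree_superset[of ?A m] mon_degree_superset[of ?A m'])
qed

lemma mon_degree_single [simp]: "mon_degree (Poly_Mapping.single i k) = k"
  by (simp add: mon_degree_def)

lemma mon_degree_0 [simp]: "mon_degree 0 = 0"
  by (simp add: mon_degree_def)

lemma mon_degree_eq_0_iff: "mon_degree m = 0 \<longleftrightarrow> m = 0"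
proof
  assume "mon_degree m = 0"
  then have "\<forall>i\<in>Poly_Mapping.keys m. Poly_Mapping.lookup m i = 0" by (simp add: mon_degree_def)
  then have "i \<notin> Poly_Mapping.keys m" for i by (auto simp: in_keys_iff)
  then have "Poly_Mapping.keys m = {}" by blast
  then show "m = 0" using keys_eq_empty by blast
qed simp

abbreviation homogeneous :: "nat \<Rightarrow> qmpoly \<Rightarrow> bool" where
  "homogeneous t f \<equiv> \<forall>m\<in>Poly_Mapping.keys f. mon_degree m = t"

lemma homogeneous_sum: "(\<And>i. i \<in> I \<Longrightarrow> homogeneous t (f i)) \<Longrightarrow> homogeneous t (\<Sum>i\<in>I. f i)"
proof (induction I rule: infinite_finite_induct)
  case (insert x I)
  then show ?case using Poly_Mapping.keys_add[of "f x" "\<Sum>i\<in>I. f i"] by auto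
qed auto

lemma homogeneous_mult: "homogeneous s f \<Longrightarrow> homogeneous t g \<Longrightarrow> homogeneous (s + t) (f * g)"
  using keys_mult[of f g] by (fastforce simp: mon_degree_add)

lemma homogeneous_const_q: "homogeneous 0 (const_q c)"
  by (simp add: const_q_def)

lemma homogeneous_var_a: "homogeneous 1 (var_a i)"
  by (simp add: var_a_def)

lemma homogeneous_h_coeff: "homogeneous 2 (h_coeff d r s)"
proof -
  have "homogeneous (0 + (0 + (1 + 1))) (const_q a * (const_q b * (var_a i * var_a j)))" for a b i j
    by (intro homogeneous_mult homogeneous_const_q homogeneous_var_a)
  then show ?thesis
    unfolding h_coeff_def sum_distrib_left by (intro homogeneous_sum) (simp add: numeral_2_eq_2)
qed

definition hom_part :: "nat \<Rightarrow> qmpoly \<Rightarrow> qmpoly" where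
  "hom_part t f = (\<Sum>m | m \<in> Poly_Mapping.keys f \<and> mon_degree m = t. Poly_Mapping.single m (Poly_Mapping.lookup f m))"

lemma lookup_hom_part: "Poly_Mapping.lookup (hom_part t f) m = (if mon_degree m = t then Poly_Mapping.lookup f m else 0)"
proof -
  have "Poly_Mapping.lookup (hom_part t f) m
    = (\<Sum>m' | m' \<in> Poly_Mapping.keys f \<and> mon_degree m' = t. if m' = m then Poly_Mapping.lookup f m else 0)"
    unfolding hom_part_def lookup_sum by (intro sum.cong) (auto simp: lookup_single when_def)
  then show ?thesis by (auto simp: in_keys_iff)
qed

lemma hom_part_0 [simp]: "hom_part t 0 = 0"
  by (simp add: hom_part_def)

lemma hom_part_add: "hom_part t (f + g) = hom_part t f + hom_part t g"
  by (rule poly_mapping_eqI) (simp add: lookup_hom_part lookup_add)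

lemma hom_part_sum: "hom_part t (\<Sum>i\<in>I. f i) = (\<Sum>i\<in>I. hom_part t (f i))"
  by (induction I rule: infinite_finite_induct) (simp_all add: hom_part_add)

lemma hom_part_homogeneous: "homogeneous s f \<Longrightarrow> hom_part t f = (if s = t then f else 0)"
  by (rule poly_mapping_eqI) (auto simp: lookup_hom_part in_keys_iff)

lemma qmpoly_expand: "f = (\<Sum>m\<in>Poly_Mapping.keys f. Poly_Mapping.single m (Poly_Mapping.lookup f m :: rat))"
  by (rule poly_mapping_eqI) (auto simp: lookup_sum lookup_single when_def in_keys_iff)

lemma mult_expand: "f * g = (\<Sum>m\<in>Poly_Mapping.keys f. Poly_Mapping.single m (Poly_Mapping.lookup f m :: rat) * g)"
  using arg_cong[OF qmpoly_expand[of f], of "\<lambda>f. f * g"] by (simp only: sum_distrib_right)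

lemma single_eq_const_q: "Poly_Mapping.single m c = const_q c * Poly_Mapping.single m 1"
  by (simp add: const_q_def mult_single)

section \<open>The polynomial ring and its ideals\<close>

lemma mem_carrier_iff: "f \<in> carrier (poly_ring d) \<longleftrightarrow> (\<forall>m\<in>Poly_Mapping.keys f. Poly_Mapping.keys m \<subseteq> {0..d})"
  by (simp add: poly_ring_def)

lemma poly_ring_ops: "mult (poly_ring d) = (*)" "add (poly_ring d) = (+)" "one (poly_ring d) = 1" "zero (poly_ring d) = 0"
  by (simp_all add: poly_ring_def)

interpretation poly_ring: cring "poly_ring d" for d
  by (rule cring_poly_ring)

lemma carrier_mult: "f \<in> carrier (poly_ring d) \<Longrightarrow> g \<in> carrier (poly_ring d) \<Longrightarrow> f * g \<in> carrier (poly_ring d)"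
  using poly_ring.m_closed[of f d g] by (simp add: poly_ring_ops)

lemma carrier_add: "f \<in> carrier (poly_ring d) \<Longrightarrow> g \<in> carrier (poly_ring d) \<Longrightarrow> f + g \<in> carrier (poly_ring d)"
  using poly_ring.a_closed[of f d g] by (simp add: poly_ring_ops)

lemma carrier_0: "0 \<in> carrier (poly_ring d)" by (simp add: mem_carrier_iff)
lemma carrier_1: "1 \<in> carrier (poly_ring d)" by (simp add: mem_carrier_iff)

lemma carrier_sum: "(\<And>i. i \<in> I \<Longrightarrow> f i \<in> carrier (poly_ring d)) \<Longrightarrow> (\<Sum>i\<in>I. f i) \<in> carrier (poly_ring d)"
  by (induction I rule: infinite_finite_induct) (auto intro: carrier_add carrier_0)

lemma carrier_const_q: "const_q c \<in> carrier (poly_ring d)"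
  by (simp add: mem_carrier_iff const_q_def)

lemma carrier_single: "Poly_Mapping.keys m \<subseteq> {0..d} \<Longrightarrow> Poly_Mapping.single m c \<in> carrier (poly_ring d)"
  by (simp add: mem_carrier_iff)

lemma carrier_var_a: "i \<le> d \<Longrightarrow> var_a i \<in> carrier (poly_ring d)"
  unfolding var_a_def by (rule carrier_single) simp

lemma carrier_h_coeff:
  assumes "r \<le> d"
  shows "h_coeff d r s \<in> carrier (poly_ring d)"
proof -
  have "const_q (of_nat ((d - r) choose j) * of_nat ((d - r) choose (s - j)))
      * (const_q c * (var_a (j + i) * var_a (s - j + r - i))) \<in> carrier (poly_ring d)"
    if "i \<le> r" for i j c
  proof (cases "j \<le> d - r \<and> s - j \<le> d - r")
    case True
    then show ?thesis using that assms by (intro carrier_mult carrier_const_q carrier_var_a) auto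
  next
    case False
    then have "const_q (of_nat ((d - r) choose j) * of_nat ((d - r) choose (s - j))) = 0"
      by (auto simp: binomial_eq_0)
    then show ?thesis by (simp add: carrier_0)
  qed
  note * = this
  show ?thesis
    unfolding h_coeff_def sum_distrib_left by (intro carrier_sum *) simp
qed

lemma ideal_poly_ringI:
  assumes "I \<subseteq> carrier (poly_ring d)" "0 \<in> I" and add: "\<And>f g. f \<in> I \<Longrightarrow> g \<in> I \<Longrightarrow> f + g \<in> I"
    and mult: "\<And>r f. r \<in> carrier (poly_ring d) \<Longrightarrow> f \<in> I \<Longrightarrow> r * f \<in> I"
  shows "ideal I (poly_ring d)"
proof (rule idealI)
  show "ring (poly_ring d)" by (rule poly_ring.ring_axioms)
  show "subgroup I (add_monoid (poly_ring d))"
  proof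
    fix f assume f: "f \<in> I"
    have "- f = const_q (-1) * f" by (simp add: const_q_uminus)
    then have "- f \<in> I" using mult[OF carrier_const_q f] by metis
    moreover have "inv\<^bsub>add_monoid (poly_ring d)\<^esub> f = - f"
    proof -
      have "f \<in> carrier (poly_ring d)" "- f \<in> carrier (poly_ring d)" using f \<open>- f \<in> I\<close> assms(1) by auto
      then have "\<ominus>\<^bsub>poly_ring d\<^esub> f = - f" by (intro poly_ring.minus_equality) (simp_all add: poly_ring_ops)
      then show ?thesis by (simp add: a_inv_def)
    qed
    ultimately show "inv\<^bsub>add_monoid (poly_ring d)\<^esub> f \<in> I" by simp
  qed (use assms in \<open>auto simp: poly_ring_ops\<close>)
qed (use mult in \<open>auto simp: poly_ring_ops\<close>, metis mult mult.commute)

context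
  fixes d q :: nat
  assumes q: "2 * q \<le> d"
begin

lemma generators_carrier: "(\<Union>k\<in>{1..q}. form_coeffs (covariant_H d (2 * k))) \<subseteq> carrier (poly_ring d)"
proof (rule UN_least)
  fix k assume "k \<in> {1..q}"
  then have "2 * k \<le> d" using q by auto
  then show "form_coeffs (covariant_H d (2 * k)) \<subseteq> carrier (poly_ring d)"
    using form_coeffs_covariant_H(1) carrier_h_coeff carrier_0 by blast
qed

lemma ideal_J_ideal: "ideal (ideal_J d q) (poly_ring d)"
  unfolding ideal_J_def by (rule poly_ring.genideal_ideal[OF generators_carrier])

lemma ideal_J_mult: "r \<in> carrier (poly_ring d) \<Longrightarrow> f \<in> ideal_J d q \<Longrightarrow> r * f \<in> ideal_J d q"
  using ideal.I_l_closed[OF ideal_J_ideal] by (simp add: poly_ring_ops)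

lemma ideal_J_add: "f \<in> ideal_J d q \<Longrightarrow> g \<in> ideal_J d q \<Longrightarrow> f + g \<in> ideal_J d q"
  using additive_subgroup.a_closed[OF ideal.axioms(1)[OF ideal_J_ideal]] by (simp add: poly_ring_ops)

lemma ideal_J_0: "0 \<in> ideal_J d q"
  using additive_subgroup.zero_closed[OF ideal.axioms(1)[OF ideal_J_ideal]] by (simp add: poly_ring_ops)

lemma ideal_J_sum: "(\<And>i. i \<in> I \<Longrightarrow> f i \<in> ideal_J d q) \<Longrightarrow> (\<Sum>i\<in>I. f i) \<in> ideal_J d q"
  by (induction I rule: infinite_finite_induct) (auto intro: ideal_J_add ideal_J_0)

lemma ideal_J_minimal:
  assumes "ideal I (poly_ring d)" and "\<And>k s. 1 \<le> k \<Longrightarrow> k \<le> q \<Longrightarrow> h_coeff d (2 * k) s \<in> I"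
  shows "ideal_J d q \<subseteq> I"
  unfolding ideal_J_def
proof (rule poly_ring.genideal_minimal[OF assms(1)], rule UN_least)
  fix k assume k: "k \<in> {1..q}"
  then have "2 * k \<le> d" using q by auto
  moreover have "0 \<in> I"
    using additive_subgroup.zero_closed[OF ideal.axioms(1)[OF assms(1)]] by (simp add: poly_ring_ops)
  ultimately show "form_coeffs (covariant_H d (2 * k)) \<subseteq> I"
    using form_coeffs_covariant_H(1)[of "2 * k" d] assms(2) k by fastforce
qed

text \<open>Valid for every \<open>s\<close>: beyond the order 2(d - 2k) of the covariant each
  summand contains a vanishing binomial.\<close>

lemma h_coeff_in_ideal_J:
  assumes "1 \<le> k" "k \<le> q"
  shows "h_coeff d (2 * k) s \<in> ideal_J d q"
proof (cases "s \<le> 2 * (d - 2 * k)")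
  case True
  have "h_coeff d (2 * k) s \<in> form_coeffs (covariant_H d (2 * k))"
    using assms q True by (intro form_coeffs_covariant_H(2)) auto
  then show ?thesis
    unfolding ideal_J_def using poly_ring.genideal_self[OF generators_carrier] assms by fastforce
next
  case False
  have "h_coeff d (2 * k) s = 0"
    unfolding h_coeff_def
  proof (rule sum.neutral, rule ballI)
    fix j assume "j \<in> {..s}"
    then have "d - 2 * k < j \<or> d - 2 * k < s - j" using False by auto
    then show "const_q (of_nat ((d - 2 * k) choose j) * of_nat ((d - 2 * k) choose (s - j))) *
     (\<Sum>i\<le>2 * k. const_q ((-1) ^ i * of_nat (2 * k choose i)) * (var_a (j + i) * var_a (s - j + 2 * k - i))) = 0"
      by (auto simp: binomial_eq_0)
  qed
  then show ?thesis by (simp add: ideal_J_0)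
qed

end

section \<open>Linear functionals over Q\<close>

interpretation qmpoly: vector_space "\<lambda>c f. const_q c * f"
  by unfold_locales (simp_all add: const_q_add const_q_mult distrib_left distrib_right mult.assoc)

interpretation qmpoly_rat: vector_space_pair "\<lambda>c f. const_q c * f" "\<lambda>(c :: rat) x. c * x"
  by unfold_locales (simp_all add: algebra_simps)

lemma separating_functional:
  assumes "v \<notin> qmpoly.span S"
  obtains \<phi> where "\<And>x y. \<phi> (x + y) = \<phi> x + \<phi> y" "\<And>c x. \<phi> (const_q c * x) = c * \<phi> x"
    "\<And>x. x \<in> S \<Longrightarrow> \<phi> x = (0 :: rat)" "\<phi> v \<noteq> 0"
proof -
  obtain B where B: "B \<subseteq> S" "qmpoly.independent B" "S \<subseteq> qmpoly.span B"
    by (rule qmpoly.maximal_independent_subset)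
  have v: "v \<notin> qmpoly.span B" using assms qmpoly.span_mono[OF B(1)] by blast
  obtain \<phi> where \<phi>: "Vector_Spaces.linear (\<lambda>c f. const_q c * f) (\<lambda>(c :: rat) x. c * x) \<phi>"
    "\<forall>x\<in>insert v B. \<phi> x = (if x = v then 1 else 0)"
    using qmpoly_rat.linear_independent_extend[OF qmpoly.independent_insertI[OF v B(2)], of "\<lambda>x. if x = v then 1 else 0"] by blast
  interpret \<phi>: Vector_Spaces.linear "\<lambda>c f. const_q c * f" "\<lambda>(c :: rat) x. c * x" \<phi> by (rule \<phi>(1))
  show thesis
  proof
    show "\<phi> (x + y) = \<phi> x + \<phi> y" for x y by (rule \<phi>.add)
    show "\<phi> (const_q c * x) = c * \<phi> x" for c x by (rule \<phi>.scale)
    show "\<phi> v \<noteq> 0" using \<phi>(2) by simp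
    fix x assume "x \<in> S"
    then have "x \<in> qmpoly.span B" using B(3) by blast
    moreover have "\<phi> b = 0" if "b \<in> B" for b using \<phi>(2) that v qmpoly.span_base[of b B] by auto
    ultimately show "\<phi> x = 0" by (rule \<phi>.eq_0_on_span[rotated -1])
  qed
qed

text \<open>Degree three: a functional separating \<open>var_a k * h_coeff d n s\<close> from the ideal would be a trilinear form
  that contradicts \<open>apolar_trilinear_next\<close>.\<close>
lemma var_times_h_coeff_in_ideal_J:
  assumes n: "2 * q + 2 \<le> d" "d < 2 * (2 * q + 2)" "6 \<le> 2 * q + 2 \<or> d + 3 \<le> 2 * (2 * q + 2)" and k: "k \<le> d"
  shows "var_a k * h_coeff d (2 * q + 2) s \<in> ideal_J d q"
proof -
  have q: "2 * q \<le> d" using n by simp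
  \<comment> \<open>Products of one variable with one generator. Membership in their linear span,
    rather than in the ideal, can be tested by linear functionals.\<close>
  define S where "S = {var_a l * h_coeff d (2 * k') s' | l k' s'. l \<le> d \<and> 1 \<le> k' \<and> k' \<le> q}"
  have "S \<subseteq> ideal_J d q"
    unfolding S_def using ideal_J_mult[OF q] carrier_var_a h_coeff_in_ideal_J[OF q] by blast
  moreover have "qmpoly.subspace (ideal_J d q)"
    unfolding qmpoly.subspace_def
    using ideal_J_0[OF q] ideal_J_add[OF q] ideal_J_mult[OF q carrier_const_q] by blast
  ultimately have span: "qmpoly.span S \<subseteq> ideal_J d q"
    by (rule qmpoly.span_minimal)
  have "var_a k * h_coeff d (2 * q + 2) s \<in> qmpoly.span S"
  proof (rule ccontr)
    assume "var_a k * h_coeff d (2 * q + 2) s \<notin> qmpoly.span S"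
    then obtain \<phi> :: "qmpoly \<Rightarrow> rat" where \<phi>: "\<And>x y. \<phi> (x + y) = \<phi> x + \<phi> y" "\<And>c x. \<phi> (const_q c * x) = c * \<phi> x"
      "\<And>x. x \<in> S \<Longrightarrow> \<phi> x = 0" "\<phi> (var_a k * h_coeff d (2 * q + 2) s) \<noteq> 0"
      by (rule separating_functional) blast
    \<comment> \<open>Cut off at \<open>d\<close> to meet the support condition on trilinear arrays;
      transvectants do not see the cutoff.\<close>
    define u where "u i j l = (if i \<le> d \<and> j \<le> d \<and> l \<le> d then \<phi> (var_a i * var_a j * var_a l) else 0)" for i j l
    have u: "transvect d (\<lambda>i j. u i j l) r s' = \<phi> (var_a l * h_coeff d r s')" if "l \<le> d" "r \<le> d" for l r s'
    proof -
      have "transvect d (\<lambda>i j. u i j l) r s' = transvect d (\<lambda>i j. \<phi> (var_a i * var_a j * var_a l)) r s'"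
        using that by (intro transvect_cong) (auto simp: u_def)
      also have "\<dots> = \<phi> (h_coeff d r s' * var_a l)"
        by (rule linear_h_coeff[symmetric]) (rule \<phi>)+
      finally show ?thesis by (simp add: mult.commute)
    qed
    have "transvect d (\<lambda>i j. u i j k) (2 * q + 2) s = 0"
    proof (rule apolar_trilinear_next)
      fix i j l
      show "u i j l = u j i l" "u i j l = u i l j" by (auto simp: u_def mult_ac)
      show "u i j l = 0" if "d < i" using that by (simp add: u_def)
    next
      fix r s' l assume r: "even r" "0 < r" "r < 2 * q + 2"
      then obtain k' where k': "r = 2 * k'" "1 \<le> k'" "k' \<le> q" by (auto elim!: evenE)
      show "transvect d (\<lambda>i j. u i j l) r s' = 0"
      proof (cases "l \<le> d")
        case True
        then have "\<phi> (var_a l * h_coeff d r s') = 0" using k' by (intro \<phi>(3)) (auto simp: S_def)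
        then show ?thesis using u[of l r s'] True k' q by simp
      next
        case False
        then show ?thesis by (simp add: u_def transvect_def apolar_inner_def)
      qed
    qed (use n k in auto)
    then show False using u[of k "2 * q + 2" s] \<phi>(4) n k by simp
  qed
  then show ?thesis using span by blast
qed

text \<open>Degree three suffices: a monomial of positive degree contains a variable, and that
  variable times a new generator already lies in the smaller ideal.\<close>

lemma ideal_J_next_hom_part:
  assumes n: "2 * q + 2 \<le> d" "d < 2 * (2 * q + 2)" "6 \<le> 2 * q + 2 \<or> d + 3 \<le> 2 * (2 * q + 2)"
    and f: "f \<in> ideal_J d (q + 1)" and t: "3 \<le> t"
  shows "hom_part t f \<in> ideal_J d q"
proof -
  have q: "2 * q \<le> d" and q1: "2 * (q + 1) \<le> d" using n by simp_all
  \<comment> \<open>Quantifying over all multiples \<open>r * f\<close> makes \<open>L\<close> an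
    ideal, so only the generators have to be checked.\<close>
  define L where "L = {f \<in> carrier (poly_ring d). \<forall>r\<in>carrier (poly_ring d). \<forall>t\<ge>3. hom_part t (r * f) \<in> ideal_J d q}"
  have "ideal L (poly_ring d)"
  proof (rule ideal_poly_ringI)
    show "L \<subseteq> carrier (poly_ring d)" by (auto simp: L_def)
    show "0 \<in> L" by (simp add: L_def carrier_0 ideal_J_0[OF q])
    show "f + g \<in> L" if "f \<in> L" "g \<in> L" for f g
      using that by (auto simp: L_def carrier_add distrib_left hom_part_add intro: ideal_J_add[OF q])
    show "r * f \<in> L" if "r \<in> carrier (poly_ring d)" "f \<in> L" for r f
      using that by (auto simp: L_def carrier_mult mult.assoc[symmetric])
  qed
  moreover have "h_coeff d (2 * k) s \<in> L" if k: "1 \<le> k" "k \<le> q + 1" for k s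
    unfolding L_def
  proof (intro CollectI conjI ballI allI impI)
    show "h_coeff d (2 * k) s \<in> carrier (poly_ring d)" using k q1 by (intro carrier_h_coeff) simp
    fix r t assume r: "r \<in> carrier (poly_ring d)" and t: "(3::nat) \<le> t"
    have mono: "Poly_Mapping.single m 1 * h_coeff d (2 * k) s \<in> ideal_J d q"
      if m: "m \<noteq> 0" "Poly_Mapping.keys m \<subseteq> {0..d}" for m
    proof (cases "k \<le> q")
      case True
      then show ?thesis
        using k m by (intro ideal_J_mult[OF q] carrier_single h_coeff_in_ideal_J[OF q]) auto
    next
      case False
      then have k: "2 * k = 2 * q + 2" using k by simp
      obtain l where l: "l \<in> Poly_Mapping.keys m" using m(1) keys_eq_empty by blast
      define m' where "m' = m - Poly_Mapping.single l 1"
      have m': "m = m' + Poly_Mapping.single l 1"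
        using l by (intro poly_mapping_eqI) (auto simp: m'_def lookup_add lookup_minus lookup_single when_def in_keys_iff)
      have "Poly_Mapping.keys m' \<subseteq> Poly_Mapping.keys m"
        by (auto simp: m'_def in_keys_iff lookup_minus)
      then have "Poly_Mapping.single m' 1 * (var_a l * h_coeff d (2 * k) s) \<in> ideal_J d q"
        unfolding k using m l by (intro ideal_J_mult[OF q] carrier_single var_times_h_coeff_in_ideal_J n) auto
      moreover have "Poly_Mapping.single m (1::rat) = Poly_Mapping.single m' 1 * var_a l"
        by (simp add: m' var_a_def mult_single)
      ultimately show ?thesis by (simp only: mult.assoc)
    qed
    have "r * h_coeff d (2 * k) s
      = (\<Sum>m\<in>Poly_Mapping.keys r. Poly_Mapping.single m (Poly_Mapping.lookup r m) * h_coeff d (2 * k) s)"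
      by (rule mult_expand)
    then have "hom_part t (r * h_coeff d (2 * k) s)
      = (\<Sum>m\<in>Poly_Mapping.keys r. hom_part t (Poly_Mapping.single m (Poly_Mapping.lookup r m) * h_coeff d (2 * k) s))"
      by (simp only: hom_part_sum)
    also have "\<dots> \<in> ideal_J d q"
    proof (rule ideal_J_sum[OF q])
      fix m assume m: "m \<in> Poly_Mapping.keys r"
      have hom: "homogeneous (mon_degree m + 2) (Poly_Mapping.single m (Poly_Mapping.lookup r m) * h_coeff d (2 * k) s)"
        by (rule homogeneous_mult[OF _ homogeneous_h_coeff]) simp
      show "hom_part t (Poly_Mapping.single m (Poly_Mapping.lookup r m) * h_coeff d (2 * k) s) \<in> ideal_J d q"
      proof (cases "mon_degree m + 2 = t")
        case True
        then have "m \<noteq> 0" using t by auto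
        moreover have "Poly_Mapping.keys m \<subseteq> {0..d}" using r m by (simp add: mem_carrier_iff)
        ultimately have "const_q (Poly_Mapping.lookup r m) * (Poly_Mapping.single m 1 * h_coeff d (2 * k) s) \<in> ideal_J d q"
          by (intro ideal_J_mult[OF q] carrier_const_q mono)
        then show ?thesis
          unfolding hom_part_homogeneous[OF hom] using True by (simp add: single_eq_const_q[of m "Poly_Mapping.lookup r m"] mult.assoc)
      next
        case False
        then show ?thesis unfolding hom_part_homogeneous[OF hom] by (simp add: ideal_J_0[OF q])
      qed
    qed
    finally show "hom_part t (r * h_coeff d (2 * k) s) \<in> ideal_J d q" .
  qed
  ultimately have "ideal_J d (q + 1) \<subseteq> L" by (intro ideal_J_minimal[OF q1]) auto
  then have "hom_part t (1 * f) \<in> ideal_J d q" using f t carrier_1 unfolding L_def by blast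
  then show ?thesis by simp
qed

lemma ideal_J_mono:
  assumes "2 * (q + 1) \<le> d"
  shows "ideal_J d q \<subseteq> ideal_J d (q + 1)"
proof (rule ideal_J_minimal)
  show "ideal (ideal_J d (q + 1)) (poly_ring d)" by (rule ideal_J_ideal[OF assms])
qed (use assms h_coeff_in_ideal_J[OF assms] in auto)

lemma quadratic_monomial_eq:
  assumes "Poly_Mapping.single i (1::nat) + Poly_Mapping.single j 1 = Poly_Mapping.single k 1 + Poly_Mapping.single l 1"
  shows "i = k \<and> j = l \<or> i = l \<and> j = k"
proof -
  have "Poly_Mapping.lookup (Poly_Mapping.single i (1::nat) + Poly_Mapping.single j 1) x
    = Poly_Mapping.lookup (Poly_Mapping.single k 1 + Poly_Mapping.single l 1) x" for x by (simp only: assms)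
  from this[of i] this[of j] show ?thesis
    by (auto simp: lookup_add lookup_single when_def split: if_splits)
qed

text \<open>A quadratic monomial determines its two indices up to order, so by symmetry of
  \<open>u\<close> the choice made in \<open>val\<close> does not matter.\<close>

lemma quadratic_functional:
  fixes u :: "nat \<Rightarrow> nat \<Rightarrow> rat"
  assumes sym: "\<And>i j. u i j = u j i"
  obtains \<phi> where "\<And>x y. \<phi> (x + y) = \<phi> x + \<phi> y" "\<And>c x. \<phi> (const_q c * x) = c * \<phi> x"
    "\<And>i j. \<phi> (var_a i * var_a j) = u i j" "\<And>t f. homogeneous t f \<Longrightarrow> t \<noteq> 2 \<Longrightarrow> \<phi> f = (0 :: rat)"
proof -
  define val where "val m = (if \<exists>i j. m = Poly_Mapping.single i (1::nat) + Poly_Mapping.single j 1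
    then u (fst (SOME (i, j). m = Poly_Mapping.single i 1 + Poly_Mapping.single j 1))
           (snd (SOME (i, j). m = Poly_Mapping.single i 1 + Poly_Mapping.single j 1)) else 0)" for m
  have val: "val (Poly_Mapping.single i 1 + Poly_Mapping.single j 1) = u i j" for i j
  proof -
    let ?m = "Poly_Mapping.single i (1::nat) + Poly_Mapping.single j 1"
    define p where "p = (SOME (i, j). ?m = Poly_Mapping.single i (1::nat) + Poly_Mapping.single j 1)"
    have "case p of (k, l) \<Rightarrow> ?m = Poly_Mapping.single k (1::nat) + Poly_Mapping.single l 1"
      unfolding p_def by (rule someI[of _ "(i, j)"]) simp
    then have "i = fst p \<and> j = snd p \<or> i = snd p \<and> j = fst p"
      using quadratic_monomial_eq[of i j "fst p" "snd p"] by (simp add: case_prod_beta)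
    moreover have "val ?m = u (fst p) (snd p)" unfolding val_def p_def by auto
    ultimately show ?thesis using sym by auto
  qed
  define \<phi> where "\<phi> f = (\<Sum>m\<in>Poly_Mapping.keys f. Poly_Mapping.lookup f m * val m)" for f :: qmpoly
  have \<phi>: "\<phi> f = (\<Sum>m\<in>A. Poly_Mapping.lookup f m * val m)" if "finite A" "Poly_Mapping.keys f \<subseteq> A" for f A
    unfolding \<phi>_def using that by (intro sum.mono_neutral_left) (auto simp: in_keys_iff)
  show thesis
  proof
    fix x y :: qmpoly and c :: rat
    let ?A = "Poly_Mapping.keys x \<union> Poly_Mapping.keys y"
    have "\<phi> (x + y) = (\<Sum>m\<in>?A. Poly_Mapping.lookup (x + y) m * val m)"
      by (rule \<phi>) (simp_all add: Poly_Mapping.keys_add)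
    then show "\<phi> (x + y) = \<phi> x + \<phi> y"
      by (simp add: lookup_add distrib_right sum.distrib \<phi>[of ?A x] \<phi>[of ?A y])
    have look: "Poly_Mapping.lookup (const_q c * x) m = c * Poly_Mapping.lookup x m" for m
      by (simp add: const_q_def mult_map_scale_conv_mult[symmetric] Poly_Mapping.map.rep_eq when_def)
    then have "Poly_Mapping.keys (const_q c * x) \<subseteq> Poly_Mapping.keys x"
      by (auto simp only: in_keys_iff mult_zero_right)
    then have "\<phi> (const_q c * x) = (\<Sum>m\<in>Poly_Mapping.keys x. Poly_Mapping.lookup (const_q c * x) m * val m)"
      by (rule \<phi>[OF finite_keys])
    also have "\<dots> = c * (\<Sum>m\<in>Poly_Mapping.keys x. Poly_Mapping.lookup x m * val m)"
      unfolding look sum_distrib_left by (simp only: mult.assoc)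
    finally show "\<phi> (const_q c * x) = c * \<phi> x" unfolding \<phi>_def[of x] .
  next
    fix i j
    have "var_a i * var_a j = Poly_Mapping.single (Poly_Mapping.single i 1 + Poly_Mapping.single j 1) 1"
      by (simp add: var_a_def mult_single)
    then show "\<phi> (var_a i * var_a j) = u i j" by (simp add: \<phi>_def val[unfolded One_nat_def])
  next
    fix t :: nat and f :: qmpoly assume f: "homogeneous t f" "t \<noteq> 2"
    have "val m = 0" if "m \<in> Poly_Mapping.keys f" for m
    proof -
      have "mon_degree m \<noteq> 2" using f that by auto
      then have "\<not> (\<exists>i j. m = Poly_Mapping.single i (1::nat) + Poly_Mapping.single j 1)"
        by (auto simp: mon_degree_add)
      then show ?thesis unfolding val_def by (rule if_not_P)
    qed
    then show "\<phi> f = 0" by (simp add: \<phi>_def)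
  qed
qed

text \<open>The functional belonging to \<open>apolar_form\<close> kills the lower generators and is
  positive on the new one. Being zero outside degree two, it kills all multiples of the lower
  generators as well, and these conditions define the ideal \<open>K\<close>.\<close>

lemma h_coeff_not_in_ideal_J:
  assumes "2 * q + 2 \<le> d"
  shows "h_coeff d (2 * q + 2) 0 \<notin> ideal_J d q"
proof
  assume mem: "h_coeff d (2 * q + 2) 0 \<in> ideal_J d q"
  have q: "2 * q \<le> d" using assms by simp
  define u where "u = apolar_form d (2 * q + 2)"
  have sym: "u i j = u j i" for i j
  proof (cases "i + j = 2 * q + 2")
    case True
    then have "even i \<longleftrightarrow> even j" by (metis even_add even_mult_iff even_numeral)
    moreover have "2 * q + 2 choose i = 2 * q + 2 choose j" using True by (metis binomial_symmetric add_diff_cancel_left' le_add1)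
    ultimately show ?thesis unfolding u_def apolar_form_def using True
      by (cases "even i") (simp_all add: add.commute mult.commute del: binomial_Suc_Suc)
  qed (simp add: u_def apolar_form_def add.commute)
  obtain \<phi> :: "qmpoly \<Rightarrow> rat" where add: "\<And>x y. \<phi> (x + y) = \<phi> x + \<phi> y" and scale: "\<And>c x. \<phi> (const_q c * x) = c * \<phi> x"
    and u: "\<And>i j. \<phi> (var_a i * var_a j) = u i j" and zero: "\<And>t f. homogeneous t f \<Longrightarrow> t \<noteq> 2 \<Longrightarrow> \<phi> f = 0"
    by (rule quadratic_functional[of u, OF sym]) blast
  have h: "\<phi> (h_coeff d r s) = transvect d u r s" for r s
    using linear_h_coeff[of \<phi> d r s 1, OF add scale] u by simp
  have z: "\<phi> 0 = 0" using scale[of 0 0] by simp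
  have sum: "\<phi> (\<Sum>i\<in>I. f i) = (\<Sum>i\<in>I. \<phi> (f i))" for I :: "(nat \<Rightarrow>\<^sub>0 nat) set" and f
    by (induction I rule: infinite_finite_induct) (simp_all add: z add)
  define K where "K = {f \<in> carrier (poly_ring d). \<forall>r\<in>carrier (poly_ring d). \<phi> (r * f) = 0}"
  have "ideal K (poly_ring d)"
  proof (rule ideal_poly_ringI)
    show "K \<subseteq> carrier (poly_ring d)" by (auto simp: K_def)
    show "0 \<in> K" by (simp add: K_def carrier_0 z)
    show "f + g \<in> K" if "f \<in> K" "g \<in> K" for f g
      using that by (auto simp: K_def carrier_add distrib_left add)
    show "r * f \<in> K" if "r \<in> carrier (poly_ring d)" "f \<in> K" for r f
      using that by (auto simp: K_def carrier_mult mult.assoc[symmetric])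
  qed
  moreover have "h_coeff d (2 * k) s \<in> K" if k: "1 \<le> k" "k \<le> q" for k s
    unfolding K_def
  proof (intro CollectI conjI ballI)
    show "h_coeff d (2 * k) s \<in> carrier (poly_ring d)" using k q by (intro carrier_h_coeff) simp
    fix r assume "r \<in> carrier (poly_ring d)"
    have "r * h_coeff d (2 * k) s
      = (\<Sum>m\<in>Poly_Mapping.keys r. Poly_Mapping.single m (Poly_Mapping.lookup r m) * h_coeff d (2 * k) s)"
      by (rule mult_expand)
    then have "\<phi> (r * h_coeff d (2 * k) s)
      = (\<Sum>m\<in>Poly_Mapping.keys r. \<phi> (Poly_Mapping.single m (Poly_Mapping.lookup r m) * h_coeff d (2 * k) s))"
      by (simp only: sum)
    also have "\<dots> = 0"
    proof (rule sum.neutral, rule ballI)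
      fix m
      show "\<phi> (Poly_Mapping.single m (Poly_Mapping.lookup r m) * h_coeff d (2 * k) s) = 0"
      proof (cases "m = 0")
        case True
        have "\<phi> (h_coeff d (2 * k) s) = 0"
          unfolding h u_def using assms k by (intro transvect_apolar_form_zero) auto
        then show ?thesis using scale[of "Poly_Mapping.lookup r m"] True by (simp add: const_q_def)
      next
        case False
        have hom: "homogeneous (mon_degree m + 2) (Poly_Mapping.single m (Poly_Mapping.lookup r m) * h_coeff d (2 * k) s)"
          by (rule homogeneous_mult[OF _ homogeneous_h_coeff]) simp
        show ?thesis by (rule zero[OF hom]) (simp add: mon_degree_eq_0_iff False)
      qed
    qed
    finally show "\<phi> (r * h_coeff d (2 * k) s) = 0" .
  qed
  ultimately have "ideal_J d q \<subseteq> K" by (rule ideal_J_minimal[OF q])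
  then have "h_coeff d (2 * q + 2) 0 \<in> K" using mem by blast
  then have "\<phi> (1 * h_coeff d (2 * q + 2) 0) = 0" using carrier_1 unfolding K_def by blast
  then show False using transvect_apolar_form_pos[OF assms] by (simp add: h u_def)
qed

text \<open>The value is at most 3 because the parts of degree at least three agree; it is not
  smaller because the parts of degree two differ.\<close>

theorem sat_alpha_eq_3:
  assumes n: "2 * q + 2 \<le> d" "d < 2 * (2 * q + 2)" "6 \<le> 2 * q + 2 \<or> d + 3 \<le> 2 * (2 * q + 2)"
  shows "sat_alpha d q = 3"
  unfolding sat_alpha_def
proof (rule Least_equality)
  show "\<forall>t\<ge>3. graded_part (ideal_J d q) t = graded_part (ideal_J d (q + 1)) t"
  proof (intro allI impI equalityI subsetI)
    fix t :: nat and f :: qmpoly assume "f \<in> graded_part (ideal_J d q) t"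
    then show "f \<in> graded_part (ideal_J d (q + 1)) t"
      using ideal_J_mono[of q d] n unfolding graded_part_def by auto
  next
    fix t :: nat and f :: qmpoly assume t: "3 \<le> t" and f: "f \<in> graded_part (ideal_J d (q + 1)) t"
    then have "hom_part t f \<in> ideal_J d q" using ideal_J_next_hom_part[OF n] by (simp add: graded_part_def)
    moreover have "hom_part t f = f" using f by (subst hom_part_homogeneous[where s = t]) (auto simp: graded_part_def)
    ultimately show "f \<in> graded_part (ideal_J d q) t" using f by (simp add: graded_part_def)
  qed
next
  fix y assume y: "\<forall>t\<ge>y. graded_part (ideal_J d q) t = graded_part (ideal_J d (q + 1)) t"
  have "h_coeff d (2 * (q + 1)) 0 \<in> ideal_J d (q + 1)"
    by (rule h_coeff_in_ideal_J) (use n in auto)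
  then have "h_coeff d (2 * q + 2) 0 \<in> graded_part (ideal_J d (q + 1)) 2"
    using homogeneous_h_coeff by (simp add: graded_part_def)
  then have "graded_part (ideal_J d q) 2 \<noteq> graded_part (ideal_J d (q + 1)) 2"
    using h_coeff_not_in_ideal_J[OF n(1)] by (auto simp: graded_part_def)
  then show "3 \<le> y" using y by (metis not_less_eq_eq numeral_2_eq_2 numeral_3_eq_3)
qed

theorem theorem1p4:
  fixes s d :: nat
  assumes "1 \<le> s" and "s \<le> 8" and "d \<ge> bound_N s"
  shows "\<forall>j. 1 \<le> j \<and> j \<le> s \<longrightarrow> sat_alpha d (d div 2 - j) = 3"
proof (intro allI impI)
  fix j assume j: "1 \<le> j \<and> j \<le> s"
  have "s \<in> {1, 2, 3, 4, 5, 6, 7, 8}" using assms(1,2) by auto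
  \<comment> \<open>For s >= 3 the bound is exactly 4s - 2; the clause with 8 records the larger
    value at s = 2.\<close>
  then have "4 \<le> d \<and> 4 * s \<le> d + 2 \<and> (s = 1 \<or> 8 \<le> d)" using assms(3) by (auto simp: bound_N_def)
  then have d: "4 \<le> d" "4 * j \<le> d + 2" "j = 1 \<or> 8 \<le> d" using j by auto
  define q where "q = d div 2 - j"
  have "j \<le> d div 2" using d(1,2) by simp
  then have "q + j = d div 2" by (simp add: q_def)
  then have dq: "d = 2 * (q + j) \<or> d = 2 * (q + j) + 1" by auto
  have jq: "j \<le> q + 1" using dq d(2) by auto
  have "sat_alpha d q = 3"
  proof (rule sat_alpha_eq_3)
    show "2 * q + 2 \<le> d" using dq j by auto
    show "d < 2 * (2 * q + 2)" using dq jq by auto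
    \<comment> \<open>With n = 2q + 2: n = 2 would force d <= 3, and n = 4 with d >= 6 would force j
      = 2 and d = 6 or 7, below the bound 8.\<close>
    show "6 \<le> 2 * q + 2 \<or> d + 3 \<le> 2 * (2 * q + 2)" using dq jq d(1,3) by auto
  qed
  then show "sat_alpha d (d div 2 - j) = 3" by (simp add: q_def)
qed

end
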